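(* Let $A_5(n)$ be defined by $\sum_{n\ge 0}A_5(n)q^n=\dfrac{f_5^{10}}{f_1^2}$, and let $\{B_k\}_{k\ge 0}$ be defined by $B_0=0$, $B_1=1$ and $B_k=-4B_{k-1}-8B_{k-2}+\dfrac{8^k-1}{7}$ for $k\ge 2$. Then for all integers $n\ge 0$ and $k\ge 1$, \[ A_5(2^{k+1}n+3\cdot 2^k-2) = B_kA_5(4n+4)+\left(\frac{8^{k+1}-1}{7}-9B_k\right)A_5(2n+1). \] Consequently, for all integers $m\ge0$ and $n\ge 0$, \[ A_5(2^{4m+4}n+3\cdot 2^{4m+3}-2)\equiv 0\pmod{\frac{8^{4m+4}-1}{91}}. \]
   Context: For $m\in\mathbb{N}$ and $|q|<1$, $f_m:=\prod_{n\ge1}(1-q^{mn})$. $A_5(n)$ is the number of partition pairs of $n$ with $5$-cores; its generating function is $\sum_{n\ge0}A_5(n)q^n=f_5^{10}/f_1^2$. *)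

theory Defs
  imports "HOL-Computational_Algebra.Formal_Power_Series"
begin

text \<open>Truncation of f_m = prod_{j>=1} (1 - q^{m j}) to the factors j = 1..N,
  as an integer formal power series. Coefficients of degree \<le> N agree with f_m.\<close>
definition f_trunc :: "nat \<Rightarrow> nat \<Rightarrow> int fps" where
  "f_trunc m N = (\<Prod>j\<in>{1..N}. 1 - fps_X ^ (m * j))"

text \<open>Truncation of 1/f_1 = prod_{j>=1} 1/(1-q^j), each factor 1/(1-q^j) written as
  the geometric series sum_i q^{j i}.\<close>
definition f1_inv_trunc :: "nat \<Rightarrow> int fps" where
  "f1_inv_trunc N = (\<Prod>j\<in>{1..N}. Abs_fps (\<lambda>i. if j dvd i then 1 else 0))"

text \<open>A_5(n) = coefficient of q^n in f_5^10 / f_1^2 (only factors j \<le> n matter).\<close>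
definition A5 :: "nat \<Rightarrow> int" where
  "A5 n = fps_nth (f_trunc 5 n ^ 10 * f1_inv_trunc n ^ 2) n"

text \<open>B_0 = 0, B_1 = 1, B_k = -4 B_{k-1} - 8 B_{k-2} + (8^k - 1)/7; the division is exact.\<close>
fun B :: "nat \<Rightarrow> int" where
  "B 0 = 0"
| "B (Suc 0) = 1"
| "B (Suc (Suc k)) = -4 * B (Suc k) - 8 * B k + (8 ^ (k + 2) - 1) div 7"

end

theory Submission
  imports Defs
    "HOL-Computational_Algebra.Polynomial_Factorial"
    "HOL-Computational_Algebra.Formal_Laurent_Series"
begin

text \<open>
  Let F = q^2 f_5^10 / f_1^2, so that A_5(N - 2) is the coefficient of q^N in F, and let
  C = q f_1^4 f_5^4. The Hecke operator T_2 satisfies T_2 F = 9 F + C and T_2 C = -4 C, so for odd M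
  the sequences F(2^k M) and C(2^k M) obey linear recurrences, which B_k solves; at k = 4m + 3 the
  contribution of C vanishes because (-2 + 2i)^4 is real.

  For the Hecke relations put u = f_5^2 f_2^4 / (q f_10^4 f_1^2), the quotient of psi(q)^2 by
  q psi(q^5)^2. Then u - 1 and u - 5 are eta quotients, with F / p^2 = (u - 1)^2 and
  C / p^2 = u (u - 5)^2 for p = q^2 f_10^5 / f_2. Since f_1(-q) = f_2^3 / (f_1 f_4), comparing eta
  quotients shows that u(q) and u(-q) are the roots of a quadratic over the field generated by
  v = u(q^2): their sum is 4v / (v - 1) and their product is -v (v - 5) / (v - 1).

  The two facts about u - 1 and u - 5 amount to psi(q)^2 - q psi(q^5)^2 = f(q, q^4) f(q^2, q^3)
  and phi(-q^5)^2 - phi(-q)^2 = 4 q f(-q, -q^9) f(-q^3, -q^7). Both express a sum over the Gaussian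
  integers as the part in the ideal (2 + i) plus the other four residue classes, which
  multiplication by i permutes cyclically. Jacobi's triple product turns them into products.
\<close>

unbundle fps_syntax

section \<open>The finite Jacobi triple product\<close>

lemma mult_eq_swap:
  fixes a b c d e :: "'a :: comm_semiring_1"
  assumes "a * c = b * d"
  shows "a * e * c = b * (d * e)"
proof -
  have "a * e * c = a * c * e" by (simp only: ac_simps)
  with assms show ?thesis by (simp only: ac_simps)
qed

text \<open>The Gaussian binomial [n, k] in base p. Defining it by its Pascal rule avoids division,
  so it makes sense in any commutative ring.\<close>

fun gbinom :: "'a :: comm_ring_1 \<Rightarrow> nat \<Rightarrow> nat \<Rightarrow> 'a" where
  "gbinom p n 0 = 1"
| "gbinom p 0 (Suc k) = 0"
| "gbinom p (Suc n) (Suc k) = gbinom p n k + p ^ Suc k * gbinom p n (Suc k)"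

lemma gbinom_eq_0: "n < k \<Longrightarrow> gbinom p n k = 0"
  by (induction p n k rule: gbinom.induct) auto

lemma gbinom_self [simp]: "gbinom p n n = 1"
  by (induction n) (auto simp: gbinom_eq_0)

text \<open>The finite Pochhammer product (p; p)_n.\<close>

definition qprod :: "'a :: comm_ring_1 \<Rightarrow> nat \<Rightarrow> 'a" where
  "qprod p n = (\<Prod>j\<in>{1..n}. 1 - p ^ j)"

lemma qprod_0 [simp]: "qprod p 0 = 1"
  and qprod_Suc: "qprod p (Suc n) = qprod p n * (1 - p ^ Suc n)"
  by (simp_all add: qprod_def)

text \<open>Division-free form of [m + l, m] = (p; p)_(m+l) / ((p; p)_m (p; p)_l). The Pascal rule
  reduces it to (1 - p^m) + p^m (1 - p^l) = 1 - p^(m+l).\<close>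

lemma gbinom_qprod: "gbinom p (m + l) m * qprod p m * qprod p l = qprod p (m + l)"
proof (induction "m + l" arbitrary: m l)
  case (Suc n)
  show ?case
  proof (cases m)
    case (Suc m')
    note m = this
    have 1: "gbinom p (m' + l) m' * qprod p m' * qprod p l = qprod p (m' + l)"
      using Suc.hyps m by auto
    have 2: "p ^ m * gbinom p (m' + l) m * qprod p m * qprod p l
        = p ^ m * (1 - p ^ l) * qprod p (m' + l)"
    proof (cases l)
      case (Suc l')
      then have "gbinom p (m + l') m * qprod p m * qprod p l' = qprod p (m + l')"
        using Suc.hyps(1)[of m l'] Suc.hyps(2) by auto
      moreover have "m + l' = m' + l" using m Suc by simp
      ultimately have "gbinom p (m' + l) m * qprod p m * qprod p l' = qprod p (m' + l)" by simp
      moreover have "qprod p l = qprod p l' * (1 - p ^ l)" using Suc by (simp add: qprod_Suc)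
      ultimately have "p ^ m * (1 - p ^ l) * qprod p (m' + l)
          = p ^ m * (1 - p ^ l) * (gbinom p (m' + l) m * qprod p m * qprod p l')" by simp
      then show ?thesis using \<open>qprod p l = _\<close> by (simp only: ac_simps)
    qed (use m in \<open>simp add: gbinom_eq_0\<close>)
    have "gbinom p (m + l) m * qprod p m * qprod p l
        = (1 - p ^ m) * (gbinom p (m' + l) m' * qprod p m' * qprod p l)
          + p ^ m * gbinom p (m' + l) m * qprod p m * qprod p l"
      using m by (simp add: qprod_Suc algebra_simps)
    also have "\<dots> = (1 - p ^ (m + l)) * qprod p (m' + l)"
      unfolding 1 2 by (simp add: algebra_simps power_add)
    finally show ?thesis using m by (simp add: qprod_Suc algebra_simps)
  qed auto
qed auto

text \<open>The other Pascal rule follows from the first by induction, because p^(k+1) p^(n-k) and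
  p^(n-k') p^k with k = k' + 1 are both p^(n+1). \<open>finite_jacobi\<close> needs one rule for
  each of its two products.\<close>

lemma gbinom_Suc_Suc':
  "k \<le> n \<Longrightarrow> gbinom p (Suc n) (Suc k) = p ^ (n - k) * gbinom p n k + gbinom p n (Suc k)"
proof (induction n arbitrary: k)
  case (Suc n)
  show ?case
  proof (cases "k = Suc n")
    case False
    with Suc.prems have k: "k \<le> n" by simp
    show ?thesis
    proof (cases k)
      case 0
      show ?thesis using Suc.IH[of 0] k 0 by (simp add: algebra_simps)
    next
      case (Suc k')
      have e: "p ^ Suc k * p ^ (n - k) = p ^ Suc n" "p ^ (n - k') * p ^ k = p ^ Suc n"
        using k Suc by (simp_all add: power_add[symmetric] del: power_Suc)
      have "gbinom p (Suc (Suc n)) (Suc k)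
          = gbinom p (Suc n) k + p ^ Suc k * gbinom p (Suc n) (Suc k)"
        by simp
      also have "\<dots> = (p ^ (n - k') * gbinom p n k' + gbinom p n k)
          + p ^ Suc k * (p ^ (n - k) * gbinom p n k + gbinom p n (Suc k))"
        using Suc.IH[of k] Suc.IH[of k'] k Suc by (simp del: gbinom.simps(3))
      also have "\<dots> = (p ^ (n - k') * gbinom p n k' + gbinom p n k)
          + ((p ^ Suc k * p ^ (n - k)) * gbinom p n k + p ^ Suc k * gbinom p n (Suc k))"
        by (simp only: distrib_left mult.assoc)
      also have "\<dots> = p ^ (n - k') * (gbinom p n k' + p ^ k * gbinom p n k)
          + (gbinom p n k + p ^ Suc k * gbinom p n (Suc k))"
        unfolding e(1) e(2)[symmetric] by (simp only: distrib_left ac_simps)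
      also have "\<dots> = p ^ (Suc n - k) * gbinom p (Suc n) k + gbinom p (Suc n) (Suc k)"
        using Suc by simp
      finally show ?thesis .
    qed
  qed (auto simp: gbinom_eq_0)
qed auto

section \<open>Triangular numbers and the finite triple product\<close>

definition tri :: "int \<Rightarrow> nat" where "tri k = nat (k * (k + 1) div 2)"

lemma tri: "2 * int (tri k) = k * (k + 1)"
proof -
  have "k * (k + 1) \<ge> 0" by (cases "k \<ge> 0") (auto simp: mult_nonpos_nonpos)
  moreover have "even (k * (k + 1))" by auto
  ultimately show ?thesis unfolding tri_def by simp
qed

lemma tri_minus [simp]: "tri (- k - 1) = tri k"
  unfolding tri_def by (simp add: algebra_simps)

text \<open>The general term of Ramanujan's f(x, y), with k running over all integers.\<close>

definition jterm :: "'a :: comm_ring_1 \<Rightarrow> 'a \<Rightarrow> int \<Rightarrow> 'a" where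
  "jterm x y k = x ^ tri k * y ^ tri (k - 1)"

text \<open>Formally, consecutive terms have quotient x (x y)^k. As k may be negative, both sides
  carry a factor that makes every exponent natural; \<open>jterm_down\<close> does the same for
  y.\<close>

lemma jterm_up:
  assumes "k \<le> int m"
  shows "jterm x y k * (x * (x * y) ^ m) = jterm x y (k + 1) * (x * y) ^ nat (int m - k)"
proof -
  have "int (tri (k + 1) + nat (int m - k)) = int (tri k + 1 + m)"
    "int (tri k + nat (int m - k)) = int (tri (k - 1) + m)"
    using tri[of "k + 1"] tri[of k] tri[of "k - 1"] assms by (auto simp: algebra_simps)
  then have e: "tri (k + 1) + nat (int m - k) = tri k + 1 + m"
      "tri k + nat (int m - k) = tri (k - 1) + m"
    by linarith+
  have "jterm x y (k + 1) * (x * y) ^ nat (int m - k)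
      = x ^ (tri (k + 1) + nat (int m - k)) * y ^ (tri k + nat (int m - k))"
    by (simp add: jterm_def power_add power_mult_distrib algebra_simps)
  then show ?thesis unfolding e by (simp add: jterm_def power_add power_mult_distrib algebra_simps)
qed

lemma jterm_down:
  assumes "k \<ge> - int l"
  shows "jterm x y k * (y * (x * y) ^ l) = jterm x y (k - 1) * (x * y) ^ nat (int l + k)"
proof -
  have "int (tri (k - 1) + nat (int l + k)) = int (tri k + l)"
    "int (tri (k - 2) + nat (int l + k)) = int (tri (k - 1) + 1 + l)"
    using tri[of "k - 2"] tri[of k] tri[of "k - 1"] assms by (auto simp: algebra_simps)
  then have e: "tri (k - 1) + nat (int l + k) = tri k + l"
      "tri (k - 2) + nat (int l + k) = tri (k - 1) + 1 + l"
    by linarith+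
  have "jterm x y (k - 1) * (x * y) ^ nat (int l + k)
      = x ^ (tri (k - 1) + nat (int l + k)) * y ^ (tri (k - 2) + nat (int l + k))"
    by (simp add: jterm_def power_add power_mult_distrib algebra_simps)
  then show ?thesis unfolding e by (simp add: jterm_def power_add power_mult_distrib algebra_simps)
qed

text \<open>Multiplying the sum by a new factor of either product shifts the summation index, by
  \<open>jterm_up\<close> or \<open>jterm_down\<close>, and the two copies of the sum merge by a
  Pascal rule. The inner induction on m uses \<open>gbinom_Suc_Suc'\<close>, the outer one on l the
  defining rule.\<close>

theorem finite_jacobi:
  "(\<Prod>j<m. 1 + x * (x * y) ^ j) * (\<Prod>j<l. 1 + y * (x * y) ^ j)
     = (\<Sum>k\<le>m + l. jterm x y (int k - int l) * gbinom (x * y) (m + l) k)"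
proof (induction l)
  case 0
  show ?case
  proof (induction m)
    case 0
    show ?case by (simp add: jterm_def tri_def)
  next
    case (Suc m)
    let ?p = "x * y"
    have "(\<Sum>k\<le>m. jterm x y (int k) * gbinom ?p m k) * (x * ?p ^ m)
        = (\<Sum>k\<le>m. jterm x y (int (Suc k)) * (?p ^ (m - k) * gbinom ?p m k))"
      unfolding sum_distrib_right
    proof (intro sum.cong refl)
      fix k assume "k \<in> {..m}"
      then have "jterm x y (int k) * (x * ?p ^ m) = jterm x y (int (Suc k)) * ?p ^ (m - k)"
        using jterm_up[of "int k" m x y] by (simp add: nat_diff_distrib add.commute)
      then show "jterm x y (int k) * gbinom ?p m k * (x * ?p ^ m)
          = jterm x y (int (Suc k)) * (?p ^ (m - k) * gbinom ?p m k)"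
        by (rule mult_eq_swap)
    qed
    moreover have "(\<Sum>k\<le>m. jterm x y (int k) * gbinom ?p m k)
        = 1 + (\<Sum>k\<le>m. jterm x y (int (Suc k)) * gbinom ?p m (Suc k))"
    proof -
      \<comment> \<open>The term k = m + 1 is zero; adding it lets the sum be reindexed from k +
        1.\<close>
      have "(\<Sum>k\<le>m. jterm x y (int k) * gbinom ?p m k)
          = (\<Sum>k\<le>Suc m. jterm x y (int k) * gbinom ?p m k)"
        by (simp add: gbinom_eq_0)
      also have "\<dots> = 1 + (\<Sum>k\<le>m. jterm x y (int (Suc k)) * gbinom ?p m (Suc k))"
        by (subst sum.atMost_Suc_shift) (simp add: jterm_def tri_def)
      finally show ?thesis .
    qed
    moreover have "(\<Sum>k\<le>Suc m. jterm x y (int k) * gbinom ?p (Suc m) k)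
        = 1 + (\<Sum>k\<le>m. jterm x y (int (Suc k)) * (?p ^ (m - k) * gbinom ?p m k + gbinom ?p m (Suc
            k)))"
      by (subst sum.atMost_Suc_shift) (simp add: jterm_def tri_def gbinom_Suc_Suc'
          del: gbinom.simps(3))
    ultimately show ?case using Suc by (simp add: algebra_simps sum.distrib)
  qed
next
  case (Suc l)
  let ?p = "x * y" and ?N = "m + l"
  have 1: "(\<Sum>k\<le>?N. jterm x y (int k - int l) * gbinom ?p ?N k) * (y * ?p ^ l)
      = (\<Sum>k\<le>?N. jterm x y (int k - int (Suc l)) * (?p ^ k * gbinom ?p ?N k))"
    unfolding sum_distrib_right
  proof (intro sum.cong refl)
    fix k
    have "jterm x y (int k - int l) * (y * ?p ^ l) = jterm x y (int k - int (Suc l)) * ?p ^ k"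
      using jterm_down[of l "int k - int l" x y] by (simp add: algebra_simps)
    then show "jterm x y (int k - int l) * gbinom ?p ?N k * (y * ?p ^ l)
          = jterm x y (int k - int (Suc l)) * (?p ^ k * gbinom ?p ?N k)"
      by (rule mult_eq_swap)
  qed
  have 2: "\<dots> = jterm x y (- int (Suc l))
      + (\<Sum>k\<le>?N. jterm x y (int k - int l) * (?p ^ Suc k * gbinom ?p ?N (Suc k)))"
  proof -
    have "(\<Sum>k\<le>?N. jterm x y (int k - int (Suc l)) * (?p ^ k * gbinom ?p ?N k))
        = (\<Sum>k\<le>Suc ?N. jterm x y (int k - int (Suc l)) * (?p ^ k * gbinom ?p ?N k))"
      by (simp add: gbinom_eq_0)
    also have "\<dots> = jterm x y (- int (Suc l))
        + (\<Sum>k\<le>?N. jterm x y (int k - int l) * (?p ^ Suc k * gbinom ?p ?N (Suc k)))"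
      by (subst sum.atMost_Suc_shift) simp
    finally show ?thesis .
  qed
  have "(\<Sum>k\<le>Suc ?N. jterm x y (int k - int (Suc l)) * gbinom ?p (Suc ?N) k)
      = jterm x y (- int (Suc l)) + (\<Sum>k\<le>?N. jterm x y (int k - int l) * (gbinom ?p ?N k + ?p ^ Suc k
          * gbinom ?p ?N (Suc k)))"
    by (subst sum.atMost_Suc_shift) simp
  with 1 2 Suc show ?case by (simp add: algebra_simps sum.distrib)
qed

section \<open>Theta series\<close>

text \<open>Convergence in the q-adic topology: every coefficient is eventually constant. It carries
  identities of finite products over to infinite ones.\<close>

definition coeff_lim :: "(nat \<Rightarrow> int fps) \<Rightarrow> int fps \<Rightarrow> bool" where
  "coeff_lim S F \<longleftrightarrow> (\<forall>i. \<forall>\<^sub>F n in sequentially. S n $ i = F $ i)"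

lemma coeff_lim_const [simp, intro]: "coeff_lim (\<lambda>n. F) F"
  by (simp add: coeff_lim_def)

lemma coeff_lim_unique:
  assumes "coeff_lim S F" "coeff_lim S G" shows "F = G"
proof (rule fps_ext)
  fix i
  have "\<forall>\<^sub>F n in sequentially. S n $ i = F $ i \<and> S n $ i = G $ i"
    using assms unfolding coeff_lim_def by (auto intro: eventually_conj)
  then have "\<exists>n. S n $ i = F $ i \<and> S n $ i = G $ i"
    using eventually_happens by fastforce
  then show "F $ i = G $ i" by auto
qed

lemma coeff_lim_mult:
  assumes "coeff_lim S F" "coeff_lim T G" shows "coeff_lim (\<lambda>n. S n * T n) (F * G)"
  unfolding coeff_lim_def
proof
  fix i
  have "\<forall>\<^sub>F n in sequentially. \<forall>k\<in>{..i}. S n $ k = F $ k"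
    "\<forall>\<^sub>F n in sequentially. \<forall>k\<in>{..i}. T n $ k = G $ k"
    using assms unfolding coeff_lim_def by (auto simp: eventually_ball_finite)
  then show "\<forall>\<^sub>F n in sequentially. (S n * T n) $ i = (F * G) $ i"
    by eventually_elim (auto simp: fps_mult_nth intro!: sum.cong)
qed

lemma coeff_lim_power:
  assumes "coeff_lim S F" shows "coeff_lim (\<lambda>n. S n ^ k) (F ^ k)"
  by (induction k) (auto intro: coeff_lim_mult assms)

lemma coeff_lim_subseq:
  assumes "coeff_lim S F" "strict_mono r" shows "coeff_lim (\<lambda>n. S (r n)) F"
  using assms unfolding coeff_lim_def
  by (auto intro: eventually_subseq)

text \<open>The series sum_i w(i) q^(e(i)). A sum over an infinite fibre would silently be 0, hence
  the predicate \<open>finite_fibres\<close>.\<close>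

definition graded_sum :: "('i \<Rightarrow> nat) \<Rightarrow> ('i \<Rightarrow> int) \<Rightarrow> int fps" where
  "graded_sum e w = Abs_fps (\<lambda>n. \<Sum>i | e i = n. w i)"

definition finite_fibres :: "('i \<Rightarrow> nat) \<Rightarrow> bool" where
  "finite_fibres e \<longleftrightarrow> (\<forall>n. finite {i. e i = n})"

lemma finite_fibres_le: "finite_fibres e \<Longrightarrow> finite {i. e i \<le> n}"
proof -
  assume "finite_fibres e"
  then have "finite (\<Union>m\<le>n. {i. e i = m})" by (auto simp: finite_fibres_def)
  moreover have "{i. e i \<le> n} = (\<Union>m\<le>n. {i. e i = m})" by auto
  ultimately show ?thesis by simp
qed

lemma finite_fibres_add:
  assumes "finite_fibres e" "finite_fibres e'" shows "finite_fibres (\<lambda>(i, j). e i + e' j)"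
  unfolding finite_fibres_def
proof
  fix n
  have "{x. (\<lambda>(i, j). e i + e' j) x = n} \<subseteq> {i. e i \<le> n} \<times> {j. e' j \<le> n}" by auto
  then show "finite {x. (\<lambda>(i, j). e i + e' j) x = n}"
    using finite_fibres_le[OF assms(1)] finite_fibres_le[OF assms(2)]
        by (meson finite_SigmaI finite_subset)
qed

lemma graded_sum_mult:
  assumes "finite_fibres e" "finite_fibres e'"
  shows "graded_sum e w * graded_sum e' w' = graded_sum (\<lambda>(i, j). e i + e' j) (\<lambda>(i, j). w i * w' j)"
proof (rule fps_ext)
  fix n
  have f: "finite {i. e i = k}" "finite {i. e' i = k}" for k using assms
      by (auto simp: finite_fibres_def)
  have "(graded_sum e w * graded_sum e' w') $ n = (\<Sum>k\<le>n. \<Sum>(i, j)\<in>{i. e i = k} \<times> {j. e' j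
      = n - k}. w i * w' j)"
    by (simp add: graded_sum_def fps_mult_nth sum_product sum.cartesian_product atLeast0AtMost)
  also have "\<dots> = (\<Sum>(k, i, j)\<in>(SIGMA k:{..n}. {i. e i = k} \<times> {j. e' j = n - k}). w i * w' j)"
    using f by (subst sum.Sigma) (auto simp: case_prod_unfold)
  also have "\<dots> = (\<Sum>(i, j) | e i + e' j = n. w i * w' j)"
    by (rule sum.reindex_bij_witness[where j = snd and i = "\<lambda>(i, j). (e i, i, j)"]) auto
  finally show "(graded_sum e w * graded_sum e' w') $ n
      = graded_sum (\<lambda>(i, j). e i + e' j) (\<lambda>(i, j). w i * w' j) $ n"
    by (simp add: graded_sum_def case_prod_unfold)
qed

lemma graded_sum_shift: "fps_X ^ c * graded_sum e w = graded_sum (\<lambda>i. c + e i) w"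
proof (rule fps_ext)
  fix n
  have "{i. c + e i = n} = (if n < c then {} else {i. e i = n - c})" by auto
  then show "(fps_X ^ c * graded_sum e w) $ n = graded_sum (\<lambda>i. c + e i) w $ n"
    by (simp add: graded_sum_def fps_X_power_mult_nth)
qed

text \<open>For the Gaussian integers, \<open>cls\<close> is a multiple of the residue modulo 2 + i, and \<open>rot\<close> is multiplication by i.\<close>
lemma graded_sum_split_mod5:
  fixes cls :: "'i \<Rightarrow> int" and rot :: "'i \<Rightarrow> 'i"
  assumes fin: "finite_fibres e"
    and rot: "\<And>z. e (rot z) = e z" "\<And>z. w (rot z) = w z" "\<And>z. cls (rot z) mod 5 = 3 * cls z mod 5"
      "\<And>z. rot (rot (rot (rot z))) = z"
    and g: "bij_betw g0 UNIV {z. cls z mod 5 = 0}" "bij_betw g1 UNIV {z. cls z mod 5 = 1}"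
  shows "graded_sum e w = graded_sum (e \<circ> g0) (w \<circ> g0) + 4 * graded_sum (e \<circ> g1) (w \<circ> g1)"
proof (rule fps_ext)
  fix n
  define S where "S r = (\<Sum>z | e z = n \<and> cls z mod 5 = r. w z)" for r
  have f: "finite {z. e z = n}" using fin by (simp add: finite_fibres_def)
  have "(\<Sum>z | e z = n. w z) = (\<Sum>r\<in>{0..<5}. \<Sum>z | z \<in> {z. e z = n} \<and> cls z mod 5 = r. w z)"
    by (rule sum.group[symmetric]) (use f in auto)
  also have "\<dots> = (\<Sum>r\<in>{0,1,2,3,4}. S r)"
    unfolding S_def by (rule sum.cong) auto
  also have "\<dots> = S 0 + S 1 + S 2 + S 3 + S 4" by simp
  finally have tot: "(\<Sum>z | e z = n. w z) = S 0 + S 1 + S 2 + S 3 + S 4" .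
  \<comment> \<open>Four turns are the identity, so three turns invert one.\<close>
  have rotS: "S r = S (3 * r mod 5)" if "0 \<le> r" "r < 5" for r
    unfolding S_def
  proof (rule sum.reindex_bij_witness[where j = rot and i = "\<lambda>z. rot (rot (rot z))"])
    fix z
    show "rot z \<in> {z. e z = n \<and> cls z mod 5 = 3 * r mod 5}" if "z \<in> {z. e z = n \<and> cls z mod 5 = r}"
      using that rot(1)[of z] rot(3)[of z] mod_mult_right_eq[of 3 "cls z" 5] by auto
    show "rot (rot (rot z)) \<in> {z. e z = n \<and> cls z mod 5 = r}"
        if "z \<in> {z. e z = n \<and> cls z mod 5 = 3 * r mod 5}"
    proof -
      have c: "3 * x mod 5 = 3 * y mod 5" if "x mod 5 = y mod 5" for x y :: int
        using that by (rule mod_mult_cong[OF refl])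
      have "cls z mod 5 = 3 * r mod 5" using that by simp
      from c[OF this] have "cls (rot z) mod 5 = 3 * (3 * r) mod 5" using rot(3) by simp
      from c[OF this] have "cls (rot (rot z)) mod 5 = 3 * (3 * (3 * r)) mod 5" using rot(3) by simp
      from c[OF this] have "cls (rot (rot (rot z))) mod 5 = 3 * (3 * (3 * (3 * r))) mod 5"
          using rot(3) by simp
      \<comment> \<open>3^4 = 81 = 1 + 5 * 16.\<close>
      moreover have "3 * (3 * (3 * (3 * r))) mod 5 = r mod 5"
        using mod_mult_self2[of r 5 "16 * r"] by simp
      moreover have "r mod 5 = r" using \<open>0 \<le> r\<close> \<open>r < 5\<close> by simp
      moreover have "e (rot (rot (rot z))) = n" using that by (simp add: rot(1))
      ultimately show ?thesis by simp
    qed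
  qed (simp_all add: rot)
  \<comment> \<open>The orbit of 1 under multiplication by 3 modulo 5 is 1, 3, 4, 2, so the four
    nonzero classes contribute equally.\<close>
  have rot_eqs: "S 1 = S 3" "S 3 = S 4" "S 4 = S 2" using rotS[of 1] rotS[of 3] rotS[of 4]
      by simp_all
  have gS: "S r = (\<Sum>z | e (h z) = n. w (h z))" if h: "bij_betw h UNIV {z. cls z mod 5 = r}" for h r
  proof -
    have "bij_betw h {z. e (h z) = n} {z. e z = n \<and> cls z mod 5 = r}"
      unfolding bij_betw_def
    proof
      show "inj_on h {z. e (h z) = n}" using h by (auto simp: bij_betw_def intro: inj_on_subset)
      have "h ` UNIV = {z. cls z mod 5 = r}" using h by (simp add: bij_betw_def)
      then have "cls (h z) mod 5 = r" "cls y mod 5 = r \<Longrightarrow> \<exists>z. y = h z" for y z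
        by (auto simp: set_eq_iff image_iff)
      then show "h ` {z. e (h z) = n} = {z. e z = n \<and> cls z mod 5 = r}" by force
    qed
    then show ?thesis unfolding S_def by (rule sum.reindex_bij_betw[symmetric])
  qed
  from rot_eqs show "graded_sum e w $ n = (graded_sum (e \<circ> g0) (w \<circ> g0)
      + 4 * graded_sum (e \<circ> g1) (w \<circ> g1)) $ n"
    using tot gS[OF g(1)] gS[OF g(2)] by (simp add: graded_sum_def numeral_fps_const)
qed

text \<open>Ramanujan's f(s q^a, s q^b), with its two-sided summation over the integers; one of a, b may be 0.\<close>
definition theta :: "int \<Rightarrow> nat \<Rightarrow> nat \<Rightarrow> int fps" where
  "theta s a b = graded_sum (\<lambda>k. a * tri k + b * tri (k - 1)) (\<lambda>k. s ^ (tri k + tri (k - 1)))"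

text \<open>Integrality gives (|k| - 1) (|k| - 2) >= 0. Having the bound for both exponents allows a
  = 0 or b = 0 in \<open>theta\<close>.\<close>

lemma tri_lower: "\<bar>k\<bar> - 1 \<le> int (tri k)" "\<bar>k\<bar> - 1 \<le> int (tri (k - 1))"
proof -
  have "0 \<le> (\<bar>k\<bar> - 1) * (\<bar>k\<bar> - 2)" by (cases "\<bar>k\<bar> \<ge> 2")
      (auto simp: mult_nonneg_nonneg mult_nonpos_nonpos)
  then have "2 * (\<bar>k\<bar> - 1) \<le> k * k - \<bar>k\<bar>" by (simp add: algebra_simps)
  then show "\<bar>k\<bar> - 1 \<le> int (tri k)" "\<bar>k\<bar> - 1 \<le> int (tri (k - 1))"
    using tri[of k] tri[of "k - 1"] by (auto simp: algebra_simps)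
qed

lemma theta_exp_lower:
  assumes "a + b > 0" shows "\<bar>k\<bar> - 1 \<le> int (a * tri k + b * tri (k - 1))"
proof (cases "a > 0")
  case True
  then have "tri k \<le> a * tri k" by simp
  then show ?thesis using tri_lower(1)[of k] by linarith
next
  case False
  with assms have "tri (k - 1) \<le> b * tri (k - 1)" by simp
  then show ?thesis using tri_lower(2)[of k] by linarith
qed

lemma finite_fibres_theta:
  assumes "a + b > 0" shows "finite_fibres (\<lambda>k. a * tri k + b * tri (k - 1))"
  unfolding finite_fibres_def
proof
  fix n
  have "{k. a * tri k + b * tri (k - 1) = n} \<subseteq> {- int n - 1..int n + 1}"
    using theta_exp_lower[OF assms] by (auto simp: abs_le_iff) (smt (verit))+
  then show "finite {k. a * tri k + b * tri (k - 1) = n}" by (rule finite_subset) simp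
qed

section \<open>Jacobi triple product for power series\<close>

lemma prod_one_minus_power_dvd:
  fixes p :: "'a :: comm_ring_1"
  assumes "finite J" "\<And>j. j \<in> J \<Longrightarrow> d \<le> j"
  shows "p ^ d dvd (\<Prod>j\<in>J. 1 - p ^ j) - 1"
  using assms
proof (induction J rule: finite_induct)
  case (insert j J)
  have "p ^ d dvd (\<Prod>j\<in>J. 1 - p ^ j) - 1" "p ^ d dvd p ^ j"
    using insert by (auto simp: le_imp_power_dvd)
  then have "p ^ d dvd ((\<Prod>j\<in>J. 1 - p ^ j) - 1) - p ^ j * (\<Prod>j\<in>J. 1 - p ^ j)"
    by (simp add: dvd_diff)
  then show ?case using insert by (simp add: algebra_simps)
qed auto

lemma qprod_split: "m \<le> n \<Longrightarrow> qprod p n = qprod p m * (\<Prod>j\<in>{m<..n}. 1 - p ^ j)"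
  unfolding qprod_def by (subst prod.union_disjoint[symmetric]) (auto intro!: prod.cong)

text \<open>The limit [2n, k] -> 1 / (p; p)_infinity of the Gaussian binomials, with its rate.\<close>
lemma gbinom_mult_qprod_dvd:
  fixes p :: "'a :: idom"
  assumes nz: "\<And>n. qprod p n \<noteq> 0" and k: "k \<le> 2 * n"
  shows "p ^ Suc (min k (2 * n - k)) dvd gbinom p (2 * n) k * qprod p n - 1"
proof -
  define l where "l = 2 * n - k"
  have kl: "k + l = 2 * n" using k by (simp add: l_def)
  have g: "gbinom p (2 * n) k * qprod p k * qprod p l = qprod p (2 * n)"
    using gbinom_qprod[of p k l] kl by simp
  \<comment> \<open>Here a is the smaller and b the larger of k and 2n - k. Cancelling (p; p)_b
    leaves two products whose indices all exceed a, and each is 1 modulo p^(a+1).\<close>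
  have *: "p ^ Suc a dvd gbinom p (2 * n) k * qprod p n - 1"
    if ab: "a + b = 2 * n" "a \<le> b" "gbinom p (2 * n) k * qprod p a * qprod p b = qprod p (2 * n)"
        for a b
  proof -
    have "gbinom p (2 * n) k * qprod p a = (\<Prod>j\<in>{b<..2 * n}. 1 - p ^ j)"
      using ab qprod_split[of b "2 * n" p] nz[of b] by (auto simp: mult.commute)
    moreover have "qprod p n = qprod p a * (\<Prod>j\<in>{a<..n}. 1 - p ^ j)"
      using ab by (intro qprod_split) simp
    ultimately have "gbinom p (2 * n) k * qprod p n
        = (\<Prod>j\<in>{b<..2 * n}. 1 - p ^ j) * (\<Prod>j\<in>{a<..n}. 1 - p ^ j)"
      by (metis mult.assoc)
    moreover have "p ^ Suc a dvd (\<Prod>j\<in>{b<..2 * n}. 1 - p ^ j) - 1"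
        "p ^ Suc a dvd (\<Prod>j\<in>{a<..n}. 1 - p ^ j) - 1"
      using ab by (auto intro!: prod_one_minus_power_dvd simp del: power_Suc)
    then have "p ^ Suc a dvd ((\<Prod>j\<in>{b<..2 * n}. 1 - p ^ j) - 1) * (\<Prod>j\<in>{a<..n}. 1 - p ^ j)
        + ((\<Prod>j\<in>{a<..n}. 1 - p ^ j) - 1)"
      by (intro dvd_add dvd_mult2)
    ultimately show ?thesis by (simp add: algebra_simps)
  qed
  show ?thesis
  proof (cases "k \<le> l")
    case True
    then have "min k (2 * n - k) = k" by (simp add: l_def)
    then show ?thesis using *[of k l] kl True g by simp
  next
    case False
    then have "min k (2 * n - k) = l" by (simp add: l_def)
    then show ?thesis using *[of l k] kl False g by (simp add: ac_simps)
  qed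
qed

lemma qprod_X_power_nonzero: "c > 0 \<Longrightarrow> qprod (fps_X ^ c :: int fps) n \<noteq> 0"
proof -
  assume "c > 0"
  then have "qprod (fps_X ^ c :: int fps) n $ 0 = 1"
    by (induction n) (simp_all add: qprod_Suc power_mult[symmetric])
  then show ?thesis by auto
qed

lemma fps_nth_eq_of_X_power_dvd:
  fixes F G :: "int fps"
  assumes "fps_X ^ n dvd F - G" "i < n" shows "F $ i = G $ i"
proof -
  obtain H where "F - G = fps_X ^ n * H" using assms(1) by (auto elim: dvdE)
  then have "(F - G) $ i = 0" using assms(2) by (simp add: fps_X_power_mult_nth)
  then show ?thesis by simp
qed

text \<open>Multiply the finite identity with n factors on each side by (p; p)_n, where p = q^(a+b).
  Each binomial may then be replaced by 1 modulo q^n, so coefficient i is already final when n > i.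
  The condition on s makes x y = p free of signs.\<close>

theorem jacobi_triple_product:
  assumes s: "s * s = 1" and ab: "a + b > 0"
  shows "coeff_lim (\<lambda>n. (\<Prod>j<n. 1 + fps_const s * fps_X ^ (a + (a + b) * j))
      * (\<Prod>j<n. 1 + fps_const s * fps_X ^ (b + (a + b) * j)) * qprod (fps_X ^ (a + b)) n)
          (theta s a b)"
  unfolding coeff_lim_def
proof
  fix i
  define x y p where "x = fps_const s * fps_X ^ a" and "y = fps_const s * fps_X ^ b"
    and "p = (fps_X ^ (a + b) :: int fps)"
  define e where "e k = a * tri k + b * tri (k - 1)" for k
  define w where "w k = s ^ (tri k + tri (k - 1))" for k
  have xy: "x * y = p"
    using s by (simp add: x_def y_def p_def power_add mult_ac)
  have jt: "jterm x y k = fps_const (w k) * fps_X ^ e k" for k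
    by (simp add: jterm_def x_def y_def w_def e_def power_mult_distrib power_add power_mult
        fps_const_power fps_const_mult[symmetric] mult_ac del: fps_const_mult)
  have fac: "1 + x * p ^ j = 1 + fps_const s * fps_X ^ (a + (a + b) * j)"
    "1 + y * p ^ j = 1 + fps_const s * fps_X ^ (b + (a + b) * j)" for j
    by (simp_all add: x_def y_def p_def power_add power_mult mult.assoc)
  show "\<forall>\<^sub>F n in sequentially. ((\<Prod>j<n. 1 + fps_const s * fps_X ^ (a + (a + b) * j))
      * (\<Prod>j<n. 1 + fps_const s * fps_X ^ (b + (a + b) * j)) * qprod
          (fps_X ^ (a + b)) n) $ i = theta s a b $ i"
    using eventually_gt_at_top[of i]
  proof eventually_elim
    case (elim n)
    have "(\<Prod>j<n. 1 + fps_const s * fps_X ^ (a + (a + b) * j))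
      * (\<Prod>j<n. 1 + fps_const s * fps_X ^ (b + (a + b) * j)) * qprod p n
      = (\<Sum>k\<le>2 * n. jterm x y (int k - int n) * (gbinom p (2 * n) k * qprod p n))"
      using finite_jacobi[of x y n n] unfolding xy fac
      by (simp add: sum_distrib_right mult_2 mult.assoc)
    also have "\<dots> $ i = (\<Sum>k\<le>2 * n. jterm x y (int k - int n) $ i)"
      unfolding fps_sum_nth
    proof (intro sum.cong refl)
      fix k assume k: "k \<in> {..2 * n}"
      define d where "d = min k (2 * n - k)"
      \<comment> \<open>Far from the centre k = n the power of q in the term is large; near it the
        error of the binomial is small. As |k - n| = n - d, the two orders add up to at least
        n.\<close>
      have "int n \<le> int (e (int k - int n) + (a + b) * Suc d)"
      proof -
        have "\<bar>int k - int n\<bar> = int n - int d" using k by (auto simp: d_def)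
        moreover have "\<bar>int k - int n\<bar> - 1 \<le> int (e (int k - int n))"
          unfolding e_def by (rule theta_exp_lower[OF ab])
        moreover have "Suc d \<le> (a + b) * Suc d" using mult_le_mono1[of 1 "a + b" "Suc d"] ab by simp
        ultimately show ?thesis by linarith
      qed
      then have n: "n \<le> e (int k - int n) + (a + b) * Suc d" by linarith
      have "p ^ Suc d dvd gbinom p (2 * n) k * qprod p n - 1"
        unfolding d_def using k qprod_X_power_nonzero[OF ab]
        by (intro gbinom_mult_qprod_dvd) (auto simp: p_def)
      then have "fps_X ^ e (int k - int n) * p ^ Suc d
          dvd jterm x y (int k - int n) * (gbinom p (2 * n) k * qprod p n - 1)"
        unfolding jt by (intro mult_dvd_mono) auto
      moreover have "fps_X ^ n dvd fps_X ^ e (int k - int n) * p ^ Suc d"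
        using n unfolding p_def power_mult[symmetric] power_add[symmetric]
            by (rule le_imp_power_dvd)
      ultimately have "fps_X ^ n dvd jterm x y (int k - int n) * (gbinom p (2 * n) k
          * qprod p n) - jterm x y (int k - int n)"
        by (auto simp: right_diff_distrib intro: dvd_trans)
      then show "(jterm x y (int k - int n) * (gbinom p (2 * n) k * qprod p n)) $ i
          = jterm x y (int k - int n) $ i"
        using elim by (rule fps_nth_eq_of_X_power_dvd)
    qed
    also have "\<dots> = (\<Sum>k\<in>{- int n..int n}. jterm x y k $ i)"
      by (rule sum.reindex_bij_witness[where i = "\<lambda>k. nat (k + int n)" and j = "\<lambda>k. int k - int n"])
          auto
    also have "\<dots> = (\<Sum>k\<in>{- int n..int n}. if e k = i then w k else 0)"
      unfolding jt by (intro sum.cong) (auto simp: fps_X_power_mult_nth fps_X_power_nth)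
    also have "\<dots> = (\<Sum>k | e k = i. w k)"
    proof -
      have "{k. e k = i} \<subseteq> {- int n..int n}"
      proof
        fix k assume "k \<in> {k. e k = i}"
        then have "\<bar>k\<bar> - 1 \<le> int i" using theta_exp_lower[OF ab, of k] by (simp add: e_def)
        then show "k \<in> {- int n..int n}" using elim by auto
      qed
      then show ?thesis by (intro sum.mono_neutral_cong_right) auto
    qed
    finally show ?case by (simp add: theta_def graded_sum_def e_def w_def p_def)
  qed
qed

section \<open>Decomposition modulo 2 + i\<close>

lemma bij_betwI_inv:
  assumes "\<And>x. h x \<in> A" "\<And>x. h' (h x) = x" "\<And>y. y \<in> A \<Longrightarrow> h (h' y) = y"
  shows "bij_betw h UNIV A"
  using assms by (intro bij_betw_byWitness[where f' = h']) auto

lemma mod5_shift: "x = y + 5 * t \<Longrightarrow> x mod 5 = y mod (5 :: int)"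
  by simp

lemma div5I: "x = 5 * t \<Longrightarrow> x div 5 = (t :: int)"
  by simp

lemma mod5E:
  assumes "x mod 5 = (r :: int)" obtains t where "x = 5 * t + r"
  using assms by (metis mult_div_mod_eq)

lemma theta_mult:
  assumes "a + b > 0" "c + d > 0"
  shows "theta s a b * theta s c d
    = graded_sum (\<lambda>(i, j). (a * tri i + b * tri (i - 1)) + (c * tri j + d * tri (j - 1)))
        (\<lambda>(i, j). s ^ (tri i + tri (i - 1)) * s ^ (tri j + tri (j - 1)))"
  unfolding theta_def by (rule graded_sum_mult) (use assms finite_fibres_theta in auto)

lemma tri_add_pred: "int (tri k + tri (k - 1)) = k * k"
  using tri[of k] tri[of "k - 1"] by (simp add: algebra_simps)

lemma neg_one_power_tri: "(- 1 :: int) ^ (tri k + tri (k - 1)) = (if even k then 1 else - 1)"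
proof -
  have "even (tri k + tri (k - 1)) \<longleftrightarrow> even (int (tri k + tri (k - 1)))" by simp
  also have "\<dots> \<longleftrightarrow> even k" unfolding tri_add_pred by simp
  finally show ?thesis by (simp only: minus_one_power_iff)
qed

text \<open>\<open>theta 1 1 0\<close> is 2 psi(q), as k and -1 - k give equal exponents. The pair
  (i, j) stands for the Gaussian integer x + y I with x = 2i + 1 and y = 2j + 1, whose norm is 8
  (tri i + tri j) + 2.\<close>

lemma theta_psi:
  "theta 1 1 0 ^ 2 = fps_X * theta 1 5 0 ^ 2 + 4 * (theta 1 1 4 * theta 1 2 3)"
proof -
  define e where "e = (\<lambda>(i, j). tri i + tri j)"
  \<comment> \<open>In the coordinates x + y I, \<open>g0\<close> is multiplication by 2 + I, while
    \<open>g1\<close> sends (c, d) to (2 + I) (2c + 2d I) - 1 - I.\<close>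
  define g0 g1 where "g0 = (\<lambda>(a, b). (2 * a - b, a + 2 * b + 1 :: int))"
    and "g1 = (\<lambda>(c, d). (2 * c - d - 1, c + 2 * d - 1 :: int))"
  have fin: "finite_fibres e" using finite_fibres_add[OF finite_fibres_theta[of 1 0]
      finite_fibres_theta[of 1 0]] by (simp add: e_def)
  have rot: "e (case z of (i, j) \<Rightarrow> (- j - 1, i)) = e z" for z by (simp add: e_def split: prod.split)
  have "graded_sum e (\<lambda>_. 1) = graded_sum (e \<circ> g0) ((\<lambda>_. 1) \<circ> g0)
      + 4 * graded_sum (e \<circ> g1) ((\<lambda>_. 1) \<circ> g1)"
  \<comment> \<open>\<open>cls\<close> is x - 2y, which vanishes modulo 5 exactly on the ideal (2 +
    I); \<open>rot\<close> takes x + y I to -y + x I.\<close>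
  proof (rule graded_sum_split_mod5[where rot = "\<lambda>(i, j). (- j - 1, i)" and cls = "\<lambda>(i, j). 2
      * i - 4 * j - 1", OF fin])
    show "bij_betw g0 UNIV {z. (case z of (i, j) \<Rightarrow> 2 * i - 4 * j - 1) mod 5 = 0}"
    proof (rule bij_betwI_inv[where h' = "\<lambda>(i, j). ((2 * i + j - 1) div 5, (2 * j - i - 2) div 5)"])
      show "g0 z \<in> {z. (case z of (i, j) \<Rightarrow> 2 * i - 4 * j - 1) mod 5 = 0}" for z
        using mod5_shift[of _ 0 "- 2 * snd z - 1"]
            by (simp add: g0_def case_prod_unfold algebra_simps)
      show "(\<lambda>(i, j). ((2 * i + j - 1) div 5, (2 * j - i - 2) div 5)) (g0 z) = z" for z
        by (simp add: g0_def case_prod_unfold algebra_simps prod_eq_iff)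
      fix z :: "int \<times> int"
      assume z: "z \<in> {z. (case z of (i, j) \<Rightarrow> 2 * i - 4 * j - 1) mod 5 = 0}"
      obtain i j where ij: "z = (i, j)" by (cases z)
      from z ij have "(2 * i - 4 * j - 1) mod 5 = 0" by simp
      then obtain t where t: "2 * i - 4 * j - 1 = 5 * t + 0" by (rule mod5E)
      have "(2 * i + j - 1) = 5 * (t + j)" "(2 * j - i - 2) = 5 * (- 1 - 3 * t + i - 2 * j)"
        using t by - (algebra, algebra)
      then have "(2 * i + j - 1) div 5 = t + j" "(2 * j - i - 2) div 5 = - 1 - 3 * t + i - 2 * j"
        by (simp_all only: div5I)
      with t show "g0 ((\<lambda>(i, j). ((2 * i + j - 1) div 5, (2 * j - i - 2) div 5)) z) = z"
        unfolding ij g0_def prod.case by simp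
    qed
    show "bij_betw g1 UNIV {z. (case z of (i, j) \<Rightarrow> 2 * i - 4 * j - 1) mod 5 = 1}"
    proof (rule bij_betwI_inv[where h' = "\<lambda>(i, j). ((2 * i + j + 3) div 5, (2 * j - i + 1) div 5)"])
      show "g1 z \<in> {z. (case z of (i, j) \<Rightarrow> 2 * i - 4 * j - 1) mod 5 = 1}" for z
        using mod5_shift[of _ 1 "- 2 * snd z"] by (simp add: g1_def case_prod_unfold algebra_simps)
      show "(\<lambda>(i, j). ((2 * i + j + 3) div 5, (2 * j - i + 1) div 5)) (g1 z) = z" for z
        by (simp add: g1_def case_prod_unfold algebra_simps prod_eq_iff)
      fix z :: "int \<times> int"
      assume z: "z \<in> {z. (case z of (i, j) \<Rightarrow> 2 * i - 4 * j - 1) mod 5 = 1}"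
      obtain i j where ij: "z = (i, j)" by (cases z)
      from z ij have "(2 * i - 4 * j - 1) mod 5 = 1" by simp
      then obtain t where t: "2 * i - 4 * j - 1 = 5 * t + 1" by (rule mod5E)
      have "(2 * i + j + 3) = 5 * (t + j + 1)" "(2 * j - i + 1) = 5 * (i - 2 * j - 1 - 3 * t)"
        using t by - (algebra, algebra)
      then have "(2 * i + j + 3) div 5 = t + j + 1" "(2 * j - i + 1) div 5 = i - 2 * j - 1 - 3 * t"
        by (simp_all only: div5I)
      with t show "g1 ((\<lambda>(i, j). ((2 * i + j + 3) div 5, (2 * j - i + 1) div 5)) z) = z"
        unfolding ij g1_def prod.case by simp
    qed
    show "(case case z of (i, j) \<Rightarrow> (- j - 1, i) of (i, j) \<Rightarrow> 2 * i - 4 * j - 1) mod 5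
        = 3 * (case z of (i, j) \<Rightarrow> 2 * i - 4 * j - 1) mod (5 :: int)" for z
      by (rule mod5_shift[of _ _ "2 * snd z - 2 * fst z"])
          (simp add: case_prod_unfold algebra_simps)
  qed (auto simp: rot split: prod.split)
  moreover have "(e \<circ> g0) = (\<lambda>z. 1 + (case z of (a, b) \<Rightarrow> 5 * tri a + 5 * tri b))"
  proof
    fix z :: "int \<times> int"
    obtain a b where z: "z = (a, b)" by (cases z)
    have "int ((e \<circ> g0) z) = int (1 + (case z of (a, b) \<Rightarrow> 5 * tri a + 5 * tri b))"
      using tri[of "2 * a - b"] tri[of "a + 2 * b + 1"] tri[of a] tri[of b]
      by (simp add: z e_def g0_def algebra_simps)
    then show "(e \<circ> g0) z = 1 + (case z of (a, b) \<Rightarrow> 5 * tri a + 5 * tri b)" by linarith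
  qed
  moreover have "(e \<circ> g1) = (\<lambda>(a, b). (1 * tri a + 4 * tri (a - 1)) + (2 * tri b
      + 3 * tri (b - 1)))"
  proof
    fix z :: "int \<times> int"
    obtain a b where z: "z = (a, b)" by (cases z)
    have "int ((e \<circ> g1) z) = int ((tri a + 4 * tri (a - 1)) + (2 * tri b + 3 * tri (b - 1)))"
      using tri[of "2 * a - b - 1"] tri[of "a + 2 * b - 1"] tri[of a] tri[of b] tri[of "a - 1"]
          tri[of "b - 1"]
      by (simp add: z e_def g1_def algebra_simps)
    then show "(e \<circ> g1) z = (case z of (a, b) \<Rightarrow> (1 * tri a + 4 * tri (a - 1)) + (2 * tri b
        + 3 * tri (b - 1)))"
      unfolding z by simp
  qed
  ultimately show ?thesis
    by (simp add: power2_eq_square theta_mult e_def comp_def case_prod_unfold graded_sum_shift[of 1,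
        simplified, symmetric])
qed

text \<open>Now (i, j) is the Gaussian integer i + j I itself, graded by its norm and with sign
  (-1)^norm. Multiplication by 2 + I, of norm 5, keeps the sign; the shift by 1 in the other class
  reverses it, whence the minus sign.\<close>

lemma theta_phi:
  "theta (- 1) 1 1 ^ 2 = theta (- 1) 5 5 ^ 2 - 4 * (fps_X * (theta (- 1) 1 9 * theta (- 1) 3 7))"
proof -
  define e where "e = (\<lambda>(i, j). (tri i + tri (i - 1)) + (tri j + tri (j - 1)))"
  define w :: "int \<times> int \<Rightarrow> int" where "w = (\<lambda>(i, j). if even (i + j) then 1 else - 1)"
  \<comment> \<open>\<open>g0\<close> is multiplication by 2 + I and \<open>g1\<close> sends (a, b)
    to 1 + (2 + I) (-a + b I); the minus at a matches the exponents 1, 9 and 3, 7.\<close>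
  define g0 g1 where "g0 = (\<lambda>(a, b). (2 * a - b, a + 2 * b :: int))"
    and "g1 = (\<lambda>(a, b). (1 - 2 * a - b, 2 * b - a :: int))"
  have fin: "finite_fibres e" using finite_fibres_add[OF finite_fibres_theta[of 1 1]
      finite_fibres_theta[of 1 1]] by (simp add: e_def)
  have e: "int (e (i, j)) = i * i + j * j" for i j
    using tri_add_pred[of i] tri_add_pred[of j] by (simp add: e_def)
  have w: "(- 1 :: int) ^ (tri i + tri (i - 1)) * (- 1) ^ (tri j + tri (j - 1)) = w (i, j)" for i j
    by (simp add: neg_one_power_tri w_def)
  have rot: "e (case z of (i, j) \<Rightarrow> (- j, i)) = e z" for z
  proof -
    obtain i j where z: "z = (i, j)" by (cases z)
    show ?thesis using e[of "- j" i] e[of i j] unfolding z by simp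
  qed
  have "graded_sum e w = graded_sum (e \<circ> g0) (w \<circ> g0) + 4 * graded_sum (e \<circ> g1) (w \<circ> g1)"
  proof (rule graded_sum_split_mod5[where rot = "\<lambda>(i, j). (- j, i)" and cls = "\<lambda>(i, j). i - 2
      * j", OF fin])
    show "bij_betw g0 UNIV {z. (case z of (i, j) \<Rightarrow> i - 2 * j) mod 5 = 0}"
    proof (rule bij_betwI_inv[where h' = "\<lambda>(i, j). ((2 * i + j) div 5, (2 * j - i) div 5)"])
      show "g0 z \<in> {z. (case z of (i, j) \<Rightarrow> i - 2 * j) mod 5 = 0}" for z
        using mod5_shift[of _ 0 "- snd z"] by (simp add: g0_def case_prod_unfold algebra_simps)
      show "(\<lambda>(i, j). ((2 * i + j) div 5, (2 * j - i) div 5)) (g0 z) = z" for z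
        by (simp add: g0_def case_prod_unfold algebra_simps prod_eq_iff)
      fix z :: "int \<times> int"
      assume z: "z \<in> {z. (case z of (i, j) \<Rightarrow> i - 2 * j) mod 5 = 0}"
      obtain i j where ij: "z = (i, j)" by (cases z)
      from z ij have "(i - 2 * j) mod 5 = 0" by simp
      then obtain t where t: "i - 2 * j = 5 * t + 0" by (rule mod5E)
      have "(2 * i + j) = 5 * (2 * t + j)" "(2 * j - i) = 5 * (- t)"
        using t by - (algebra, algebra)
      then have "(2 * i + j) div 5 = 2 * t + j" "(2 * j - i) div 5 = - t"
        by (simp_all only: div5I)
      with t show "g0 ((\<lambda>(i, j). ((2 * i + j) div 5, (2 * j - i) div 5)) z) = z"
        unfolding ij g0_def prod.case by simp
    qed
    show "bij_betw g1 UNIV {z. (case z of (i, j) \<Rightarrow> i - 2 * j) mod 5 = 1}"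
    proof (rule bij_betwI_inv[where h' = "\<lambda>(i, j). ((2 - 2 * i - j) div 5, (2 * j - i + 1) div 5)"])
      show "g1 z \<in> {z. (case z of (i, j) \<Rightarrow> i - 2 * j) mod 5 = 1}" for z
        using mod5_shift[of _ 1 "- snd z"] by (simp add: g1_def case_prod_unfold algebra_simps)
      show "(\<lambda>(i, j). ((2 - 2 * i - j) div 5, (2 * j - i + 1) div 5)) (g1 z) = z" for z
        by (simp add: g1_def case_prod_unfold algebra_simps prod_eq_iff)
      fix z :: "int \<times> int"
      assume z: "z \<in> {z. (case z of (i, j) \<Rightarrow> i - 2 * j) mod 5 = 1}"
      obtain i j where ij: "z = (i, j)" by (cases z)
      from z ij have "(i - 2 * j) mod 5 = 1" by simp
      then obtain t where t: "i - 2 * j = 5 * t + 1" by (rule mod5E)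
      have "(2 - 2 * i - j) = 5 * (- 2 * t - j)" "(2 * j - i + 1) = 5 * (- t)"
        using t by - (algebra, algebra)
      then have "(2 - 2 * i - j) div 5 = - 2 * t - j" "(2 * j - i + 1) div 5 = - t"
        by (simp_all only: div5I)
      with t show "g1 ((\<lambda>(i, j). ((2 - 2 * i - j) div 5, (2 * j - i + 1) div 5)) z) = z"
        unfolding ij g1_def prod.case by simp
    qed
    show "(case case z of (i, j) \<Rightarrow> (- j, i) of (i, j) \<Rightarrow> i - 2 * j) mod 5
        = 3 * (case z of (i, j) \<Rightarrow> i - 2 * j) mod (5 :: int)" for z
      by (rule mod5_shift[of _ _ "snd z - fst z"]) (simp add: case_prod_unfold algebra_simps)
    show "w (case z of (i, j) \<Rightarrow> (- j, i)) = w z" for z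
      by (cases z) (simp add: w_def add.commute)
  qed (auto simp: rot split: prod.split)
  moreover have "(e \<circ> g0) = (\<lambda>(a, b). (5 * tri a + 5 * tri (a - 1)) + (5 * tri b
      + 5 * tri (b - 1)))"
  proof
    fix z :: "int \<times> int"
    obtain a b where z: "z = (a, b)" by (cases z)
    have "int (e (g0 (a, b))) = int ((5 * tri a + 5 * tri (a - 1)) + (5 * tri b + 5 * tri (b - 1)))"
      using tri_add_pred[of a] tri_add_pred[of b]
      by (simp add: e g0_def algebra_simps)
    then show "(e \<circ> g0) z = (case z of (a, b) \<Rightarrow> (5 * tri a + 5 * tri (a - 1)) + (5 * tri b
        + 5 * tri (b - 1)))"
      unfolding z by simp
  qed
  moreover have "(e \<circ> g1) = (\<lambda>z. 1 + (case z of (a, b) \<Rightarrow> (1 * tri a + 9 * tri (a - 1)) + (3 * tri b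
      + 7 * tri (b - 1))))"
  proof
    fix z :: "int \<times> int"
    obtain a b where z: "z = (a, b)" by (cases z)
    have "int (e (g1 (a, b))) = int (1 + ((tri a + 9 * tri (a - 1)) + (3 * tri b
        + 7 * tri (b - 1))))"
      using tri[of a] tri[of b] tri[of "a - 1"] tri[of "b - 1"]
      by (simp add: e g1_def algebra_simps)
    then show "(e \<circ> g1) z = 1 + (case z of (a, b) \<Rightarrow> (1 * tri a + 9 * tri (a - 1)) + (3 * tri b
        + 7 * tri (b - 1)))"
      unfolding z by simp
  qed
  moreover have "w \<circ> g0 = w" by (auto simp: w_def g0_def fun_eq_iff)
  moreover have "w \<circ> g1 = (\<lambda>z. - w z)" by (auto simp: w_def g1_def fun_eq_iff)
  moreover have "graded_sum e' (\<lambda>z. - w z) = - graded_sum e' w" for e'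
    by (rule fps_ext) (simp add: graded_sum_def sum_negf)
  moreover have "w = (\<lambda>(i, j). (- 1) ^ (tri i + tri (i - 1)) * (- 1) ^ (tri j + tri (j - 1)))"
    by (simp add: w)
  ultimately show ?thesis
    unfolding power2_eq_square
    by (simp add: theta_mult e_def graded_sum_shift[of 1, simplified, symmetric])
qed

section \<open>Eta quotients\<close>

lemma f_trunc_eq_qprod: "f_trunc m n = qprod (fps_X ^ m) n"
  by (simp add: f_trunc_def qprod_def power_mult)

text \<open>The series f_m of the statement.\<close>
definition euler :: "nat \<Rightarrow> int fps" where
  "euler m = Abs_fps (\<lambda>n. f_trunc m n $ n)"

lemma f_trunc_dvd:
  assumes "m > 0" "i \<le> n" shows "fps_X ^ Suc i dvd f_trunc m n - f_trunc m i"
proof -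
  have "(fps_X ^ m :: int fps) ^ Suc i dvd (\<Prod>j\<in>{i<..n}. 1 - (fps_X ^ m) ^ j) - 1"
    by (rule prod_one_minus_power_dvd) auto
  moreover have "(fps_X :: int fps) ^ Suc i dvd (fps_X ^ m) ^ Suc i"
    using assms mult_le_mono1[of 1 m "Suc i"] unfolding power_mult[symmetric]
    by (intro le_imp_power_dvd) simp
  ultimately have "fps_X ^ Suc i dvd f_trunc m i * ((\<Prod>j\<in>{i<..n}. 1 - (fps_X ^ m) ^ j) - 1)"
    by (intro dvd_mult) (rule dvd_trans)
  then show ?thesis
    unfolding f_trunc_eq_qprod qprod_split[OF assms(2)]
        by (simp only: right_diff_distrib mult_1_right)
qed

lemma f_trunc_nth_eq:
  assumes "m > 0" "k \<le> i" "i \<le> n" shows "f_trunc m n $ k = f_trunc m i $ k"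
  using f_trunc_dvd[OF assms(1,3)] fps_nth_eq_of_X_power_dvd[of "Suc i" _ _ k] assms(2) by simp

lemma coeff_lim_euler: "m > 0 \<Longrightarrow> coeff_lim (f_trunc m) (euler m)"
  unfolding coeff_lim_def
  by (auto simp: euler_def eventually_sequentially intro: f_trunc_nth_eq)

lemma coeff_lim_euler_mult:
  assumes "m > 0" "k > 0" shows "coeff_lim (\<lambda>n. f_trunc m (k * n)) (euler m)"
  by (rule coeff_lim_subseq[OF coeff_lim_euler]) (use assms in \<open>auto simp: strict_mono_def\<close>)

text \<open>Blocks of k consecutive factors separate the residue classes modulo k, so that product
  identities can be checked block by block.\<close>

lemma f_trunc_block:
  "f_trunc m (k * n) = (\<Prod>j<n. \<Prod>i\<in>{1..k}. 1 - fps_X ^ (m * (k * j + i)))"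
proof (induction n)
  case (Suc n)
  have "{1..k * Suc n} = {1..k * n} \<union> (\<lambda>i. k * n + i) ` {1..k}"
  proof (rule set_eqI)
    fix x
    have "x \<in> (\<lambda>i. k * n + i) ` {1..k} \<longleftrightarrow> k * n < x \<and> x \<le> k * n + k"
      by (auto simp: image_iff intro!: bexI[of _ "x - k * n"])
    then show "x \<in> {1..k * Suc n} \<longleftrightarrow> x \<in> {1..k * n} \<union> (\<lambda>i. k * n + i) ` {1..k}"
      by auto
  qed
  then have "f_trunc m (k * Suc n) = f_trunc m (k * n) * (\<Prod>j\<in>(\<lambda>i. k * n
      + i) ` {1..k}. 1 - fps_X ^ (m * j))"
    unfolding f_trunc_def by (simp add: prod.union_disjoint)
  also have "(\<Prod>j\<in>(\<lambda>i. k * n + i) ` {1..k}. 1 - fps_X ^ (m * j))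
      = (\<Prod>i\<in>{1..k}. 1 - fps_X ^ (m * (k * n + i)) :: int fps)"
    by (subst prod.reindex) (auto simp: inj_on_def)
  finally show ?case unfolding Suc.IH by simp
qed (simp add: f_trunc_def)

lemma f_trunc_lessThan: "f_trunc m n = (\<Prod>j<n. 1 - fps_X ^ (m * (j + 1)))"
  using f_trunc_block[of m 1 n] by simp

lemma jacobi_neg:
  "a + b > 0 \<Longrightarrow> coeff_lim (\<lambda>n. \<Prod>j<n. (1 - fps_X ^ (a + (a + b) * j)) * (1 - fps_X ^ (b + (a
      + b) * j))
      * (1 - fps_X ^ ((a + b) * (j + 1)))) (theta (- 1) a b)"
  using jacobi_triple_product[of "- 1" a b]
  by (simp add: f_trunc_eq_qprod[symmetric] f_trunc_lessThan prod.distrib fps_const_neg[symmetric]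
      del: fps_const_neg)

lemma jacobi_pos:
  "a + b > 0 \<Longrightarrow> coeff_lim (\<lambda>n. \<Prod>j<n. (1 + fps_X ^ (a + (a + b) * j)) * (1 + fps_X ^ (b + (a
      + b) * j))
      * (1 - fps_X ^ ((a + b) * (j + 1)))) (theta 1 a b)"
  using jacobi_triple_product[of 1 a b]
  by (simp add: f_trunc_eq_qprod[symmetric] f_trunc_lessThan prod.distrib)

lemma Icc_1_numeral:
  "{1..2::nat} = {1, 2}" "{1..5::nat} = {1, 2, 3, 4, 5}"
      "{1..10::nat} = {1, 2, 3, 4, 5, 6, 7, 8, 9, 10}"
  by (rule set_eqI, simp, presburger)+

lemma one_minus_double: "1 - (x :: int fps) ^ (2 * k) = (1 - x ^ k) * (1 + x ^ k)"
proof -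
  have "x ^ (2 * k) = x ^ k * x ^ k" by (simp only: mult_2 power_add)
  then show ?thesis by (simp add: algebra_simps)
qed

section \<open>Theta series as eta quotients\<close>

lemma phi_euler:
  assumes "c > 0" shows "theta (- 1) c c * euler (2 * c) = euler c ^ 2"
proof -
  have "coeff_lim (\<lambda>n. (\<Prod>j<n. (1 - fps_X ^ (c + (c + c) * j)) * (1 - fps_X ^ (c + (c + c) * j))
      * (1 - fps_X ^ ((c + c) * (j + 1)))) * f_trunc (2 * c) n) (theta (- 1) c c * euler (2 * c))"
    using assms by (intro coeff_lim_mult coeff_lim_euler jacobi_neg) auto
  moreover have "(\<Prod>j<n. (1 - fps_X ^ (c + (c + c) * j)) * (1 - fps_X ^ (c + (c + c) * j))
      * (1 - fps_X ^ ((c + c) * (j + 1)))) * f_trunc (2 * c) n = f_trunc c (2 * n) ^ 2" for n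
    unfolding f_trunc_block[of c 2] f_trunc_lessThan[of "2 * c"] prod.distrib[symmetric]
        prod_power_distrib
    by (intro prod.cong refl) (simp add: Icc_1_numeral power2_eq_square algebra_simps
        del: One_nat_def flip: mult_2)
  moreover have "coeff_lim (\<lambda>n. f_trunc c (2 * n) ^ 2) (euler c ^ 2)"
    using assms by (intro coeff_lim_power coeff_lim_euler_mult) auto
  ultimately show ?thesis using coeff_lim_unique by fastforce
qed

text \<open>The product with b = 0 begins with 1 + q^0 = 2 and stops one factor early. The
  truncations therefore agree only after multiplication by 1 + q^(c n), which tends to 1.\<close>

lemma psi_euler:
  assumes "c > 0" shows "theta 1 c 0 * euler c = 2 * euler (2 * c) ^ 2"
proof -
  let ?P = "\<lambda>n. (\<Prod>j<n. (1 + fps_X ^ (c + (c + 0) * j)) * (1 + fps_X ^ (0 + (c + 0) * j))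
      * (1 - fps_X ^ ((c + 0) * (j + 1)))) :: int fps"
  have "coeff_lim (\<lambda>n. 1 + fps_X ^ (c * n)) 1"
    unfolding coeff_lim_def
  proof
    fix i
    show "\<forall>\<^sub>F n in sequentially. (1 + fps_X ^ (c * n) :: int fps) $ i = 1 $ i"
      using eventually_gt_at_top[of i]
    proof eventually_elim
      case (elim n)
      then have "i < c * n" using assms by
          (metis less_le_trans mult_le_mono1 Suc_leI One_nat_def nat_mult_1)
      then show ?case by (simp add: fps_X_power_nth)
    qed
  qed
  then have "coeff_lim (\<lambda>n. ?P n * f_trunc c n * (1 + fps_X ^ (c * n))) (theta 1 c 0 * euler c * 1)"
    using assms by (intro coeff_lim_mult coeff_lim_euler jacobi_pos) auto
  moreover have "?P n * f_trunc c n * (1 + fps_X ^ (c * n)) = 2 * f_trunc (2 * c) n ^ 2" for n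
  proof -
    have shift: "(\<Prod>j<n. 1 + fps_X ^ (c * j)) * (1 + fps_X ^ (c * n))
        = 2 * (\<Prod>j<n. 1 + fps_X ^ (c * (j + 1)) :: int fps)"
      by (induction n) (simp_all add: mult_ac)
    have twice: "f_trunc (2 * c) n = (\<Prod>j<n. 1 + fps_X ^ (c * (j + 1))) * f_trunc c n"
      unfolding f_trunc_lessThan prod.distrib[symmetric]
      by (intro prod.cong refl) (subst mult.assoc, subst one_minus_double, rule mult.commute)
    have "?P n = (\<Prod>j<n. 1 + fps_X ^ (c * (j + 1))) * (\<Prod>j<n. 1 + fps_X ^ (c * j)) * f_trunc c n"
      unfolding f_trunc_lessThan prod.distrib[symmetric] by (simp add: algebra_simps)
    then have "?P n * f_trunc c n * (1 + fps_X ^ (c * n))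
        = (\<Prod>j<n. 1 + fps_X ^ (c * (j + 1))) * f_trunc c n * f_trunc c n
        * ((\<Prod>j<n. 1 + fps_X ^ (c * j)) * (1 + fps_X ^ (c * n)))"
      by (simp only: mult_ac)
    then show ?thesis unfolding shift twice by (simp only: power2_eq_square mult_ac)
  qed
  moreover have "coeff_lim (\<lambda>n. 2 * f_trunc (2 * c) n ^ 2) (2 * euler (2 * c) ^ 2)"
    using assms by (intro coeff_lim_mult coeff_lim_power coeff_lim_euler) auto
  ultimately show ?thesis using coeff_lim_unique by fastforce
qed

text \<open>The thetas supply the residues 1, 3, 7, 9 modulo 10 and two copies of f_10; f_2 and f_5
  supply the residues 2, 4, 6, 8, 5 and two more copies. One of the four copies completes
  f_1.\<close>

lemma theta_neg_euler:
  "theta (- 1) 1 9 * theta (- 1) 3 7 * (euler 2 * euler 5) = euler 1 * euler 10 ^ 3"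
proof -
  let ?P = "\<lambda>a b n. (\<Prod>j<n. (1 - fps_X ^ (a + (a + b) * j)) * (1 - fps_X ^ (b + (a + b) * j))
      * (1 - fps_X ^ ((a + b) * (j + 1)))) :: int fps"
  have "coeff_lim (\<lambda>n. ?P 1 9 n * ?P 3 7 n * (f_trunc 2 (5 * n) * f_trunc 5 (2 * n)))
      (theta (- 1) 1 9 * theta (- 1) 3 7 * (euler 2 * euler 5))"
    by (intro coeff_lim_mult coeff_lim_euler_mult jacobi_neg) auto
  moreover have "?P 1 9 n * ?P 3 7 n * (f_trunc 2 (5 * n) * f_trunc 5 (2 * n))
      = f_trunc 1 (10 * n) * f_trunc 10 n ^ 3" for n
    unfolding f_trunc_block f_trunc_lessThan[of 10] prod.distrib[symmetric] prod_power_distrib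
    by (intro prod.cong refl)
      (simp add: Icc_1_numeral power3_eq_cube add_mult_distrib2 add.commute mult_ac
          del: One_nat_def)
  moreover have "coeff_lim (\<lambda>n. f_trunc 1 (10 * n) * f_trunc 10 n ^ 3) (euler 1 * euler 10 ^ 3)"
    by (intro coeff_lim_mult coeff_lim_power coeff_lim_euler_mult coeff_lim_euler) auto
  ultimately show ?thesis using coeff_lim_unique by fastforce
qed

text \<open>The thetas supply 1 + q^j for j prime to 5 and two copies of f_5. Splitting f_10 into
  products of 1 - q^(5j) and 1 + q^(5j) gives a third copy and the missing factors 1 + q^j, which
  turn f_1 into f_2.\<close>

lemma theta_pos_euler:
  "theta 1 1 4 * theta 1 2 3 * (euler 1 * euler 10) = euler 2 * euler 5 ^ 3"
proof -
  let ?P = "\<lambda>a b n. (\<Prod>j<n. (1 + fps_X ^ (a + (a + b) * j)) * (1 + fps_X ^ (b + (a + b) * j))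
      * (1 - fps_X ^ ((a + b) * (j + 1)))) :: int fps"
  have "coeff_lim (\<lambda>n. ?P 1 4 n * ?P 2 3 n * (f_trunc 1 (5 * n) * f_trunc 10 n))
      (theta 1 1 4 * theta 1 2 3 * (euler 1 * euler 10))"
    by (intro coeff_lim_mult coeff_lim_euler_mult coeff_lim_euler jacobi_pos) auto
  moreover have "?P 1 4 n * ?P 2 3 n * (f_trunc 1 (5 * n) * f_trunc 10 n)
      = f_trunc 2 (5 * n) * f_trunc 5 n ^ 3" for n
  proof -
    have ten: "f_trunc 10 n = (\<Prod>j<n. 1 - fps_X ^ (2 * (5 * (j + 1))))"
      by (simp add: f_trunc_lessThan)
    show ?thesis
    unfolding f_trunc_block f_trunc_lessThan[of 5] ten one_minus_double prod.distrib[symmetric]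
        prod_power_distrib
    by (intro prod.cong refl)
      (simp add: Icc_1_numeral power3_eq_cube add_mult_distrib2 add.commute mult_ac
          del: One_nat_def)
  qed
  moreover have "coeff_lim (\<lambda>n. f_trunc 2 (5 * n) * f_trunc 5 n ^ 3) (euler 2 * euler 5 ^ 3)"
    by (intro coeff_lim_mult coeff_lim_power coeff_lim_euler_mult coeff_lim_euler) auto
  ultimately show ?thesis using coeff_lim_unique by fastforce
qed

section \<open>The substitutions q -> q^2 and q -> -q\<close>

lemma coeff_lim_compose: "coeff_lim S F \<Longrightarrow> coeff_lim (\<lambda>n. S n oo g) (F oo g)"
  unfolding coeff_lim_def
proof
  fix i assume "\<forall>i. \<forall>\<^sub>F n in sequentially. S n $ i = F $ i"
  then have "\<forall>\<^sub>F n in sequentially. \<forall>k\<in>{..i}. S n $ k = F $ k"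
    by (auto simp: eventually_ball_finite)
  then show "\<forall>\<^sub>F n in sequentially. (S n oo g) $ i = (F oo g) $ i"
    by eventually_elim (auto simp: fps_compose_nth intro!: sum.cong)
qed

lemma f_trunc_compose:
  assumes "g $ 0 = 0" shows "f_trunc m n oo g = (\<Prod>j\<in>{1..n}. 1 - g ^ (m * j))"
  using assms unfolding f_trunc_def
  by (simp add: fps_compose_prod_distrib fps_compose_sub_distrib fps_X_power_compose
      fps_compose_power[symmetric])

lemma euler_compose_square: "m > 0 \<Longrightarrow> euler m oo fps_X ^ 2 = euler (2 * m)"
proof -
  assume m: "m > 0"
  have "f_trunc m n oo fps_X ^ 2 = f_trunc (2 * m) n" for n
    by (simp add: f_trunc_compose) (simp add: f_trunc_def power_mult[symmetric] mult.assoc)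
  then show ?thesis
    using coeff_lim_compose[OF coeff_lim_euler[OF m], of "fps_X ^ 2"] coeff_lim_euler[of "2 * m"] m
        coeff_lim_unique by fastforce
qed

lemma euler_compose_minus_even: "m > 0 \<Longrightarrow> even m \<Longrightarrow> euler m oo (- fps_X) = euler m"
proof -
  assume m: "m > 0" "even m"
  have "f_trunc m n oo (- fps_X) = f_trunc m n" for n
    using m by (simp add: f_trunc_compose) (simp add: f_trunc_def)
  then show ?thesis
    using coeff_lim_compose[OF coeff_lim_euler[OF m(1)], of "- fps_X"] coeff_lim_euler[of m] m
        coeff_lim_unique by fastforce
qed

text \<open>For odd m the substitution changes 1 - q^(m r) to 1 + q^(m r) exactly when r is odd. The
  missing factors 1 + q^(m r) with r even come from f_(4m).\<close>

lemma euler_compose_minus_odd: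
  assumes m: "odd m"
  shows "(euler m oo (- fps_X)) * (euler m * euler (4 * m)) = euler (2 * m) ^ 3"
proof -
  have pos: "m > 0" using m by (auto intro: Nat.gr0I)
  have "coeff_lim (\<lambda>n. (f_trunc m (2 * n) oo (- fps_X)) * (f_trunc m (2 * n) * f_trunc (4 * m) n))
      ((euler m oo (- fps_X)) * (euler m * euler (4 * m)))"
    using pos by (intro coeff_lim_mult coeff_lim_compose coeff_lim_euler_mult coeff_lim_euler) auto
  moreover have "(f_trunc m (2 * n) oo (- fps_X)) * (f_trunc m (2 * n) * f_trunc (4 * m) n)
      = f_trunc (2 * m) (2 * n) * f_trunc (2 * m) n ^ 2" for n
  proof -
    have 1: "f_trunc m (2 * n) oo (- fps_X)
        = (\<Prod>j<n. (1 + fps_X ^ (m * (2 * j + 1))) * (1 - fps_X ^ (m * (2 * j + 2))))"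
      unfolding f_trunc_block using m
      by (simp add: fps_compose_prod_distrib fps_compose_mult_distrib fps_compose_sub_distrib
          fps_X_power_compose
          Icc_1_numeral del: One_nat_def)
    have 2: "f_trunc (2 * m) (2 * n) = (\<Prod>j<n. \<Prod>i\<in>{1..2}. (1 - fps_X ^ (m * (2 * j + i))) * (1
        + fps_X ^ (m * (2 * j + i))))"
      unfolding f_trunc_block by (intro prod.cong refl) (simp only: mult.assoc one_minus_double)
    have 3: "f_trunc (4 * m) n = (\<Prod>j<n. (1 - fps_X ^ (m * (2 * j + 2))) * (1 + fps_X ^ (m * (2 * j
        + 2))))"
      unfolding f_trunc_lessThan one_minus_double[symmetric]
          by (intro prod.cong refl) (simp add: algebra_simps)
    have 4: "f_trunc (2 * m) n = (\<Prod>j<n. 1 - fps_X ^ (m * (2 * j + 2)))"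
      unfolding f_trunc_lessThan by (intro prod.cong refl) (simp add: algebra_simps)
    show ?thesis
      unfolding 1 2 3 4 unfolding f_trunc_block prod.distrib[symmetric] prod_power_distrib
      by (intro prod.cong refl) (simp add: Icc_1_numeral power2_eq_square mult_ac del: One_nat_def)
  qed
  moreover have "coeff_lim (\<lambda>n. f_trunc (2 * m) (2 * n) * f_trunc (2 * m) n ^ 2) (euler (2 * m)
      * euler (2 * m) ^ 2)"
    using pos by (intro coeff_lim_mult coeff_lim_power coeff_lim_euler_mult coeff_lim_euler) auto
  ultimately show ?thesis using coeff_lim_unique
      by (fastforce simp: power3_eq_cube power2_eq_square)
qed

section \<open>Hecke relations\<close>

text \<open>Here f_i is the value of the series f_i at q; the hypotheses are the identities for psi and phi.\<close>
lemma level10_relations: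
  fixes q f1 f2 f5 f10 :: "'a :: field"
  assumes nz: "q \<noteq> 0" "f1 \<noteq> 0" "f2 \<noteq> 0" "f5 \<noteq> 0" "f10 \<noteq> 0"
    and psi: "f2^4 / f1^2 - q * f10^4 / f5^2 = f2 * f5^3 / (f1 * f10)"
    and phi: "f5^4 / f10^2 - f1^4 / f2^2 = 4 * q * f1 * f10^3 / (f2 * f5)"
  defines "u \<equiv> f5^2 * f2^4 / (q * f10^4 * f1^2)"
  shows "u - 1 = f2 * f5^5 / (q * f1 * f10^5)" "u - 5 = f1^3 * f5 / (q * f2 * f10^3)"
proof -
  have "u - 1 = (f2^4 / f1^2 - q * f10^4 / f5^2) * (f5^2 / (q * f10^4))"
    using nz by (simp add: u_def field_simps)
  also have "\<dots> = f2 * f5^5 / (q * f1 * f10^5)"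
    unfolding psi using nz by (simp add: field_simps eval_nat_numeral)
  finally show 1: "u - 1 = f2 * f5^5 / (q * f1 * f10^5)" .
  have "f2 * f5^5 / (q * f1 * f10^5) - f1^3 * f5 / (q * f2 * f10^3)
      = (f5^4 / f10^2 - f1^4 / f2^2) * (f2 * f5 / (q * f1 * f10^3))"
    using nz by (simp add: field_simps eval_nat_numeral)
  also have "\<dots> = 4"
    unfolding phi using nz by (simp add: field_simps)
  finally show "u - 5 = f1^3 * f5 / (q * f2 * f10^3)"
    using 1 by (simp add: algebra_simps)
qed

text \<open>Here g1 = f_1(-q) and g5 = f_5(-q). In the proof, u' and v are u(-q) and u(q^2).\<close>
lemma hecke_relations_field:
  fixes q f1 f2 f4 f5 f10 f20 g1 g5 :: "'a :: field"
  assumes nz: "q \<noteq> 0" "f1 \<noteq> 0" "f2 \<noteq> 0" "f4 \<noteq> 0" "f5 \<noteq> 0" "f10 \<noteq> 0" "f20 \<noteq> 0"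
    and g: "g1 = f2^3 / (f1 * f4)" "g5 = f10^3 / (f5 * f20)"
    and psi: "f2^4 / f1^2 - q * f10^4 / f5^2 = f2 * f5^3 / (f1 * f10)"
      "f2^4 / g1^2 - (-q) * f10^4 / g5^2 = f2 * g5^3 / (g1 * f10)"
      "f4^4 / f2^2 - q^2 * f20^4 / f10^2 = f4 * f10^3 / (f2 * f20)"
    and phi: "f5^4 / f10^2 - f1^4 / f2^2 = 4 * q * f1 * f10^3 / (f2 * f5)"
      "g5^4 / f10^2 - g1^4 / f2^2 = 4 * (-q) * g1 * f10^3 / (f2 * g5)"
      "f10^4 / f20^2 - f2^4 / f4^2 = 4 * q^2 * f2 * f20^3 / (f4 * f10)"
  shows "q^2 * f5^10 / f1^2 + q^2 * g5^10 / g1^2 + 16 * (q^8 * f20^10 / f4^2)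
      = 18 * (q^4 * f10^10 / f2^2) + 2 * (q^2 * f2^4 * f10^4)"
    and "q * f1^4 * f5^4 - q * g1^4 * g5^4 + 16 * (q^4 * f4^4 * f20^4) = - 8 * (q^2 * f2^4 * f10^4)"
proof -
  define u u' v p where "u = f5^2 * f2^4 / (q * f10^4 * f1^2)"
    and "u' = g5^2 * f2^4 / (- q * f10^4 * g1^2)" and "v = f10^2 * f4^4 / (q^2 * f20^4 * f2^2)"
    and "p = q^2 * f10^5 / f2"
  have nzg: "g1 \<noteq> 0" "g5 \<noteq> 0" using nz g by auto
  have u: "u - 1 = f2 * f5^5 / (q * f1 * f10^5)" "u - 5 = f1^3 * f5 / (q * f2 * f10^3)"
    using level10_relations[of q f1 f2 f5 f10] nz psi(1) phi(1) by (auto simp: u_def)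
  have u': "u' - 1 = f2 * g5^5 / (- q * g1 * f10^5)" "u' - 5 = g1^3 * g5 / (- q * f2 * f10^3)"
    using level10_relations[of "- q" g1 f2 g5 f10] nz nzg psi(2) phi(2) by (auto simp: u'_def)
  have v: "v - 1 = f4 * f10^5 / (q^2 * f2 * f20^5)" "v - 5 = f2^3 * f10 / (q^2 * f4 * f20^3)"
    using level10_relations[of "q^2" f2 f4 f10 f20] nz psi(3) phi(3) by (auto simp: v_def)
  have v1: "v - 1 \<noteq> 0" "v \<noteq> 0" using nz unfolding v by (auto simp: v_def)
  \<comment> \<open>With g1 and g5 eliminated, this and the next identity compare monomials in the
    f_i. Together they give the product and the sum of u and u'.\<close>
  have P: "u * u' * (v - 1) = - (v * (v - 5))"
    unfolding v unfolding u_def u'_def v_def g using nz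
    by (simp add: divide_simps power_mult_distrib power_mult[symmetric])
        (simp add: eval_nat_numeral algebra_simps)
  have "(u - 1) * (u' - 1) = - (v - 1)"
    unfolding u u' v g using nz
    by (simp add: divide_simps power_mult_distrib power_mult[symmetric])
        (simp add: eval_nat_numeral algebra_simps)
  hence "(u + u') * (v - 1) = u * u' * (v - 1) + (v - 1) * v" by algebra
  with P have S: "(u + u') * (v - 1) = 4 * v" by algebra
  \<comment> \<open>p^2 is F(q^2). After division by it, the values of F and C at q and -q are
    polynomials in u and u', and those at q^2 and q^4 are rational in v. Both claims then concern
    symmetric functions of u and u'.\<close>
  have F: "q^2 * f5^10 / f1^2 = p^2 * (u - 1)^2" "q^2 * g5^10 / g1^2 = p^2 * (u' - 1)^2"
    "q^4 * f10^10 / f2^2 = p^2" "q^8 * f20^10 / f4^2 = p^2 / (v - 1)^2"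
    unfolding u u' v p_def using nz nzg by (simp_all add: field_simps)
  have C: "q * f1^4 * f5^4 = p^2 * (u * (u - 5)^2)" "- (q * g1^4 * g5^4) = p^2 * (u' * (u' - 5)^2)"
    "q^2 * f2^4 * f10^4 = p^2 * (v * (v - 5)^2 / (v - 1)^2)"
    "q^4 * f4^4 * f20^4 = p^2 * (v^2 * (v - 5) / (v - 1)^3)"
    unfolding u u' v unfolding p_def u_def u'_def v_def using nz nzg
    by (simp_all add: divide_simps power_mult_distrib power_mult[symmetric])
        (simp_all add: eval_nat_numeral algebra_simps)
  have s: "u + u' = 4 * v / (v - 1)" "u * u' = - (v * (v - 5)) / (v - 1)"
    using S P v1 by (simp_all add: field_simps)
  have "(u - 1)^2 + (u' - 1)^2 = (u + u')^2 - 2 * (u * u') - 2 * (u + u') + 2" by algebra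
  also have "\<dots> = 18 + 2 * (v * (v - 5)^2 / (v - 1)^2) - 16 / (v - 1)^2"
    unfolding s using v1 by (simp add: divide_simps) algebra
  finally have 1: "(u - 1)^2 + (u' - 1)^2 + 16 / (v - 1)^2 = 18 + 2 * (v * (v - 5)^2 / (v - 1)^2)"
    by simp
  have "u * (u - 5)^2 + u' * (u' - 5)^2
      = (u + u')^3 - 3 * (u + u') * (u * u') - 10 * (u + u')^2 + 20 * (u * u') + 25 *
          (u + u')" by algebra
  also have "\<dots> = - 8 * (v * (v - 5)^2 / (v - 1)^2) - 16 * (v^2 * (v - 5) / (v - 1)^3)"
    unfolding s using v1 by (simp add: divide_simps) algebra
  finally have 2: "u * (u - 5)^2 + u' * (u' - 5)^2 + 16 * (v^2 * (v - 5) / (v - 1)^3)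
      = - 8 * (v * (v - 5)^2 / (v - 1)^2)" by simp
  show "q^2 * f5^10 / f1^2 + q^2 * g5^10 / g1^2 + 16 * (q^8 * f20^10 / f4^2)
      = 18 * (q^4 * f10^10 / f2^2) + 2 * (q^2 * f2^4 * f10^4)"
    unfolding F C(3) using arg_cong[OF 1, of "\<lambda>x. p^2 * x"] by (simp add: algebra_simps)
  have "q * f1^4 * f5^4 - q * g1^4 * g5^4 = p^2 * (u * (u - 5)^2) + p^2 * (u' * (u' - 5)^2)"
    using C(1,2) by simp
  then show "q * f1^4 * f5^4 - q * g1^4 * g5^4 + 16 * (q^4 * f4^4 * f20^4)
      = - 8 * (q^2 * f2^4 * f10^4)"
    unfolding C(3,4) using arg_cong[OF 2, of "\<lambda>x. p^2 * x"] by (simp add: algebra_simps)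
qed

section \<open>The generating function of A_5\<close>

definition A5_gf :: "int fps" where "A5_gf = Abs_fps A5"

lemma f1_inv_trunc_mult: "f1_inv_trunc n * f_trunc 1 n = 1"
proof -
  have "Abs_fps (\<lambda>i. if j dvd i then 1 else 0) * (1 - fps_X ^ j) = (1 :: int fps)" if "j \<ge> 1"
      for j :: nat
  proof (rule fps_ext)
    fix n
    have "j dvd n \<longleftrightarrow> j dvd n - j" if "j \<le> n" using that by (simp add: dvd_minus_self)
    then show "(Abs_fps (\<lambda>i. if j dvd i then 1 else 0) * (1 - fps_X ^ j)) $ n = (1 :: int fps) $ n"
      using that by (auto simp: right_diff_distrib fps_X_power_mult_right_nth dest: dvd_imp_le)
  qed
  then show ?thesis
    unfolding f1_inv_trunc_def f_trunc_def prod.distrib[symmetric] by (intro prod.neutral) auto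
qed

text \<open>\<open>A5\<close> truncates at a level depending on n, so the truncated quotients S n
  must be shown to stabilise. Their difference times the square of the truncated f_1 is small, and
  that square is a unit.\<close>

lemma A5_gf_euler: "A5_gf * euler 1 ^ 2 = euler 5 ^ 10"
proof -
  define S where "S n = f_trunc 5 n ^ 10 * f1_inv_trunc n ^ 2" for n
  have S: "S n * f_trunc 1 n ^ 2 = f_trunc 5 n ^ 10" for n
    using f1_inv_trunc_mult[of n] unfolding S_def
        by (metis mult.assoc mult.right_neutral power_mult_distrib power_one)
  have "fps_X ^ Suc i dvd S n - S i" if "i \<le> n" for i n
  proof -
    have dd: "fps_X ^ Suc i dvd f_trunc m n ^ k - f_trunc m i ^ k" if "m > 0" for m k
      using f_trunc_dvd[OF that \<open>i \<le> n\<close>] by (metis dvd_trans dvd_triv_left power_diff_sumr2)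
    have "fps_X ^ Suc i dvd (f_trunc 5 n ^ 10 - f_trunc 5 i ^ 10) - S i
        * (f_trunc 1 n ^ 2 - f_trunc 1 i ^ 2)"
      by (intro dvd_diff dvd_mult dd) auto
    also have "\<dots> = (S n - S i) * f_trunc 1 n ^ 2"
      using S[of n] S[of i] by (simp add: algebra_simps)
    finally have "fps_X ^ Suc i dvd (S n - S i) * f_trunc 1 n ^ 2 * f1_inv_trunc n ^ 2"
      by (rule dvd_mult2)
    also have "(S n - S i) * f_trunc 1 n ^ 2 * f1_inv_trunc n ^ 2
        = (S n - S i) * (f1_inv_trunc n * f_trunc 1 n) ^ 2"
      by (simp only: power_mult_distrib mult_ac)
    finally show ?thesis by (simp only: f1_inv_trunc_mult power_one mult_1_right)
  qed
  then have "coeff_lim S A5_gf"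
    unfolding coeff_lim_def eventually_sequentially
    by (metis A5_def S_def fps_nth_Abs_fps A5_gf_def fps_nth_eq_of_X_power_dvd lessI)
  then have "coeff_lim (\<lambda>n. S n * f_trunc 1 n ^ 2) (A5_gf * euler 1 ^ 2)"
    by (intro coeff_lim_mult coeff_lim_power coeff_lim_euler) auto
  moreover have "coeff_lim (\<lambda>n. f_trunc 5 n ^ 10) (euler 5 ^ 10)"
    by (intro coeff_lim_power coeff_lim_euler) auto
  ultimately show ?thesis unfolding S by (rule coeff_lim_unique)
qed

lemma euler_nonzero [simp]: "euler m \<noteq> 0"
proof -
  have "euler m $ 0 = 1" by (simp add: euler_def f_trunc_def)
  then show ?thesis by auto
qed

text \<open>\<open>theta_psi\<close> multiplied by f_1^2 f_5^2 f_10; the common factor 4 comes from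
  (2 psi)^2 and from the four residue classes.\<close>

lemma psi_identity:
  "euler 2 ^ 4 * euler 5 ^ 2 * euler 10 = fps_X * euler 10 ^ 5 * euler 1 ^ 2
      + euler 2 * euler 5 ^ 5 * euler 1"
proof -
  have 1: "theta 1 1 0 * euler 1 = 2 * euler 2 ^ 2" "theta 1 5 0 * euler 5 = 2 * euler 10 ^ 2"
    using psi_euler[of 1] psi_euler[of 5] by simp_all
  have "4 * (euler 2 ^ 4 * euler 5 ^ 2 * euler 10)
      = 4 * (fps_X * euler 10 ^ 5 * euler 1 ^ 2 + euler 2 * euler 5 ^ 5 * euler 1)"
    using 1 theta_psi theta_pos_euler by algebra
  then show ?thesis by (simp only: mult_cancel_left) simp
qed

lemma phi_identity:
  "euler 5 ^ 5 * euler 2 ^ 2 - euler 1 ^ 4 * euler 10 ^ 2 * euler 5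
      = 4 * fps_X * euler 1 * euler 10 ^ 5 * euler 2"
proof -
  have "theta (- 1) 1 1 * euler 2 = euler 1 ^ 2" "theta (- 1) 5 5 * euler 10 = euler 5 ^ 2"
    using phi_euler[of 1] phi_euler[of 5] by simp_all
  then have "(euler 5 ^ 5 * euler 2 ^ 2 - euler 1 ^ 4 * euler 10 ^ 2 * euler 5)
     = 4 * fps_X * euler 1 * euler 10 ^ 5 * euler 2"
    using theta_phi theta_neg_euler by algebra
  then show ?thesis .
qed

section \<open>The Hecke relations for integer power series\<close>

definition eta_F :: "int fps" where "eta_F = fps_X ^ 2 * A5_gf"

definition eta_C :: "int fps" where "eta_C = fps_X * euler 1 ^ 4 * euler 5 ^ 4"

lemmas compose_simps = fps_compose_mult_distrib fps_compose_power[symmetric] fps_compose_add_distrib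
  fps_compose_sub_distrib euler_compose_square euler_compose_minus_even

text \<open>In weight 4, 2 (T_2 G)(q^2) = G(q) + G(-q) + 16 G(q^4). These are thus T_2 F = 9 F + C
  and T_2 C = -4 C, doubled and taken at q^2, which avoids an operator on coefficients.\<close>

lemma hecke_series:
  shows "eta_F + (eta_F oo - fps_X) + 16 * ((eta_F oo fps_X ^ 2) oo fps_X ^ 2)
      = 18 * (eta_F oo fps_X ^ 2) + 2 * (eta_C oo fps_X ^ 2)"
    and "eta_C + (eta_C oo - fps_X) + 16 * ((eta_C oo fps_X ^ 2) oo fps_X ^ 2)
        = - 8 * (eta_C oo fps_X ^ 2)"
proof -
  define g1 g5 where "g1 = euler 1 oo - fps_X" and "g5 = euler 5 oo - fps_X"
  define h2 where "h2 = A5_gf oo fps_X ^ 2"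
  define h4 where "h4 = h2 oo fps_X ^ 2"
  define h' where "h' = A5_gf oo - fps_X"
  have g: "g1 * (euler 1 * euler 4) = euler 2 ^ 3" "g5 * (euler 5 * euler 20) = euler 10 ^ 3"
    unfolding g1_def g5_def using euler_compose_minus_odd[of 1] euler_compose_minus_odd[of 5]
        by simp_all
  have psi': "euler 2 ^ 4 * g5 ^ 2 * euler 10
      = - fps_X * euler 10 ^ 5 * g1 ^ 2 + euler 2 * g5 ^ 5 * g1"
    and phi': "g5 ^ 5 * euler 2 ^ 2 - g1 ^ 4 * euler 10 ^ 2 * g5
        = 4 * - fps_X * g1 * euler 10 ^ 5 * euler 2"
    using arg_cong[OF psi_identity, of "\<lambda>F. F oo - fps_X"]
        arg_cong[OF phi_identity, of "\<lambda>F. F oo - fps_X"]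
    by (simp_all add: compose_simps g1_def g5_def)
  have psi2: "euler 4 ^ 4 * euler 10 ^ 2 * euler 20
      = fps_X ^ 2 * euler 20 ^ 5 * euler 2 ^ 2 + euler 4 * euler 10 ^ 5 * euler 2"
    and phi2: "euler 10 ^ 5 * euler 4 ^ 2 - euler 2 ^ 4 * euler 20 ^ 2 * euler 10
        = 4 * fps_X ^ 2 * euler 2 * euler 20 ^ 5 * euler 4"
    using arg_cong[OF psi_identity, of "\<lambda>F. F oo fps_X ^ 2"]
        arg_cong[OF phi_identity, of "\<lambda>F. F oo fps_X ^ 2"]
    by (simp_all add: compose_simps)
  have h': "h' * g1 ^ 2 = g5 ^ 10" and h2: "h2 * euler 2 ^ 2 = euler 10 ^ 10"
    using arg_cong[OF A5_gf_euler, of "\<lambda>F. F oo - fps_X"]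
        arg_cong[OF A5_gf_euler, of "\<lambda>F. F oo fps_X ^ 2"]
    by (simp_all add: compose_simps g1_def g5_def h'_def h2_def)
  have h4: "h4 * euler 4 ^ 2 = euler 20 ^ 10"
    using arg_cong[OF h2, of "\<lambda>F. F oo fps_X ^ 2"] by (simp add: compose_simps h4_def)
  have F: "eta_F = fps_X ^ 2 * A5_gf" "eta_F oo - fps_X = fps_X ^ 2 * h'"
      "eta_F oo fps_X ^ 2 = fps_X ^ 4 * h2"
    "(eta_F oo fps_X ^ 2) oo fps_X ^ 2 = fps_X ^ 8 * h4"
    by (simp_all add: eta_F_def compose_simps h'_def h2_def h4_def flip: power_mult)
  have C: "eta_C = fps_X * euler 1 ^ 4 * euler 5 ^ 4"
      "eta_C oo - fps_X = - (fps_X * g1 ^ 4 * g5 ^ 4)"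
    "eta_C oo fps_X ^ 2 = fps_X ^ 2 * euler 2 ^ 4 * euler 10 ^ 4"
    "(eta_C oo fps_X ^ 2) oo fps_X ^ 2 = fps_X ^ 4 * euler 4 ^ 4 * euler 20 ^ 4"
    by (simp_all add: eta_C_def compose_simps g1_def g5_def flip: power_mult)
  \<comment> \<open>The eta quotients are formed in the fraction field of the integer power series;
    \<open>to_fract\<close> is injective, so the resulting identities descend.\<close>
  define e where "e m = to_fract (euler m)" for m
  define q where "q = to_fract (fps_X :: int fps)"
  define G1 G5 where "G1 = to_fract g1" and "G5 = to_fract g5"
  have pow: "to_fract (x ^ n) = to_fract x ^ n" for x :: "int fps" and n by (induction n) simp_all
  have num: "to_fract (numeral k) = (numeral k :: int fps fract)" for k
    by (metis Fract_of_nat_eq of_nat_numeral to_fract_def)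
  note fr = arg_cong[of _ _ "to_fract :: int fps \<Rightarrow> _"]
  have nz: "e m \<noteq> 0" "q \<noteq> 0" for m by (simp_all add: e_def q_def)
  have G: "G1 * (e 1 * e 4) = e 2 ^ 3" "G5 * (e 5 * e 20) = e 10 ^ 3"
    using g[THEN fr] by (simp_all add: e_def G1_def G5_def pow)
  then have G': "G1 = e 2 ^ 3 / (e 1 * e 4)" "G5 = e 10 ^ 3 / (e 5 * e 20)"
      and nzG: "G1 \<noteq> 0" "G5 \<noteq> 0"
    using nz by (auto simp: field_simps)
  have psi_div: "a2 ^ 4 / a1 ^ 2 - r * a10 ^ 4 / a5 ^ 2 = a2 * a5 ^ 3 / (a1 * a10)"
    if "a2 ^ 4 * a5 ^ 2 * a10 = r * a10 ^ 5 * a1 ^ 2 + a2 * a5 ^ 5 * a1" "a1 \<noteq> 0" "a5 \<noteq> 0" "a10 \<noteq> 0"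
    for a1 a2 a5 a10 r :: "int fps fract"
    using that by (simp add: divide_simps) algebra
  have phi_div: "a5 ^ 4 / a10 ^ 2 - a1 ^ 4 / a2 ^ 2 = 4 * r * a1 * a10 ^ 3 / (a2 * a5)"
    if "a5 ^ 5 * a2 ^ 2 - a1 ^ 4 * a10 ^ 2 * a5 = 4 * r * a1 * a10 ^ 5 * a2" "a2 \<noteq> 0" "a5 \<noteq> 0"
        "a10 \<noteq> 0"
    for a1 a2 a5 a10 r :: "int fps fract"
    using that by (simp add: divide_simps) algebra
  note rel = hecke_relations_field[of q "e 1" "e 2" "e 4" "e 5" "e 10" "e 20" G1 G5,
      OF nz(2) nz(1) nz(1) nz(1) nz(1) nz(1) nz(1) G' psi_div psi_div psi_div phi_div phi_div
          phi_div]
  have psis: "e 2 ^ 4 * e 5 ^ 2 * e 10 = q * e 10 ^ 5 * e 1 ^ 2 + e 2 * e 5 ^ 5 * e 1"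
    "e 2 ^ 4 * G5 ^ 2 * e 10 = - q * e 10 ^ 5 * G1 ^ 2 + e 2 * G5 ^ 5 * G1"
    "e 4 ^ 4 * e 10 ^ 2 * e 20 = q ^ 2 * e 20 ^ 5 * e 2 ^ 2 + e 4 * e 10 ^ 5 * e 2"
    using psi_identity[THEN fr] psi'[THEN fr] psi2[THEN fr]
    by (simp_all add: e_def G1_def G5_def q_def pow)
  have phis: "e 5 ^ 5 * e 2 ^ 2 - e 1 ^ 4 * e 10 ^ 2 * e 5 = 4 * q * e 1 * e 10 ^ 5 * e 2"
    "G5 ^ 5 * e 2 ^ 2 - G1 ^ 4 * e 10 ^ 2 * G5 = 4 * - q * G1 * e 10 ^ 5 * e 2"
    "e 10 ^ 5 * e 4 ^ 2 - e 2 ^ 4 * e 20 ^ 2 * e 10 = 4 * q ^ 2 * e 2 * e 20 ^ 5 * e 4"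
    using phi_identity[THEN fr] phi'[THEN fr] phi2[THEN fr]
    by (simp_all add: e_def G1_def G5_def q_def pow num)
  have gf: "to_fract A5_gf = e 5 ^ 10 / e 1 ^ 2" "to_fract h' = G5 ^ 10 / G1 ^ 2"
    "to_fract h2 = e 10 ^ 10 / e 2 ^ 2" "to_fract h4 = e 20 ^ 10 / e 4 ^ 2"
    using A5_gf_euler[THEN fr] h'[THEN fr] h2[THEN fr] h4[THEN fr] nz nzG
    by (simp_all add: e_def G1_def G5_def pow eq_divide_eq)
  have "to_fract (eta_F + (eta_F oo - fps_X) + 16 * ((eta_F oo fps_X ^ 2) oo fps_X ^ 2))
      = to_fract (18 * (eta_F oo fps_X ^ 2) + 2 * (eta_C oo fps_X ^ 2))"
    using rel(1) psis phis nz nzG unfolding F(4) unfolding F(2,3) C(3) unfolding F(1)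
    by (simp add: pow num gf flip: e_def q_def G1_def G5_def)
  then show "eta_F + (eta_F oo - fps_X) + 16 * ((eta_F oo fps_X ^ 2) oo fps_X ^ 2)
      = 18 * (eta_F oo fps_X ^ 2) + 2 * (eta_C oo fps_X ^ 2)"
    by (simp only: to_fract_eq_iff)
  have "to_fract (eta_C + (eta_C oo - fps_X) + 16 * ((eta_C oo fps_X ^ 2) oo fps_X ^ 2))
      = to_fract (- 8 * (eta_C oo fps_X ^ 2))"
    using rel(2) psis phis nz nzG unfolding C(4) unfolding C(2,3) unfolding C(1)
    by (simp add: pow num flip: e_def q_def G1_def G5_def)
  then show "eta_C + (eta_C oo - fps_X) + 16 * ((eta_C oo fps_X ^ 2) oo fps_X ^ 2)
      = - 8 * (eta_C oo fps_X ^ 2)"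
    by (simp only: to_fract_eq_iff)
qed

section \<open>Recurrences along powers of 2\<close>

lemma hecke_coeff:
  shows "eta_F $ (2 * n) + 8 * (if even n then eta_F $ (n div 2) else 0)
      = 9 * eta_F $ n + eta_C $ n"
    and "eta_C $ (2 * n) + 8 * (if even n then eta_C $ (n div 2) else 0) = - 4 * eta_C $ n"
  \<comment> \<open>At q^(2n), G(q) and G(-q) agree, and G(q^4) contributes only if n is even; a
    factor 2 cancels throughout.\<close>
  using arg_cong[OF hecke_series(1), of "\<lambda>F. F $ (2 * n)"]
      arg_cong[OF hecke_series(2), of "\<lambda>F. F $ (2 * n)"]
  by (simp_all add: fps_compose_uminus' fps_nth_compose_X_power numeral_fps_const
      fps_mult_left_const_nth split: if_splits)

text \<open>The sum of the cubes of the divisors of 2^k.\<close>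
definition sigma3 :: "nat \<Rightarrow> int" where "sigma3 k = (8 ^ (k + 1) - 1) div 7"

lemma sigma3: "7 * sigma3 k = 8 ^ (k + 1) - 1"
proof -
  have "(8 - 1 :: int) dvd 8 ^ (k + 1) - 1 ^ (k + 1)" by (metis dvd_triv_left power_diff_sumr2)
  then show ?thesis by (simp add: sigma3_def)
qed

lemma sigma3_rec: "sigma3 (Suc (Suc k)) = 9 * sigma3 (Suc k) - 8 * sigma3 k"
  using sigma3[of k] sigma3[of "Suc k"] sigma3[of "Suc (Suc k)"] by simp

text \<open>The eigenvalue of C under the Hecke operator of index 2^k; it is Im ((-2 + 2i)^(k + 1)) / 2.\<close>
fun tau :: "nat \<Rightarrow> int" where
  "tau 0 = 1"
| "tau (Suc 0) = - 4"
| "tau (Suc (Suc k)) = - 4 * tau (Suc k) - 8 * tau k"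

text \<open>By \<open>sigma3_rec\<close>, s(k+2) + 4 s(k+1) + 8 s(k) = 13 s(k+1) for s =
  \<open>sigma3\<close>, so sigma3 / 13 is a particular solution of the recurrence of
  \<open>B\<close>, and \<open>tau\<close> solves the homogeneous one.\<close>

lemma B_eq_sigma3_tau: "13 * B k = sigma3 k - tau k"
proof (induction k rule: B.induct)
  case (3 k)
  have "B (Suc (Suc k)) = - 4 * B (Suc k) - 8 * B k + sigma3 (Suc k)" by (simp add: sigma3_def)
  with 3 sigma3_rec[of k] show ?case by simp
qed (simp_all add: sigma3_def)

text \<open>(-2 + 2i)^4 = -64 means tau (k + 4) = -64 tau k, and tau 3 = 0.\<close>

lemma tau_zero: "tau (4 * m + 3) = 0"
proof (induction m)
  case (Suc m)
  have "4 * Suc m + 3 = Suc (Suc (Suc (Suc (4 * m + 3))))" by simp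
  then show ?case using Suc by (simp only: tau.simps) simp
qed (simp add: numeral_eq_Suc)

text \<open>13 F + C is an eigenvector: T_2 (13 F + C) = 9 (13 F + C). Its coefficients at 2^k M
  therefore follow \<open>sigma3\<close> and those of C follow \<open>tau\<close>; for odd M there
  is no term at M / 2 in the first step.\<close>

lemma coeff_doubling:
  assumes M: "odd M"
  shows "eta_C $ (2 ^ k * M) = tau k * eta_C $ M"
    and "13 * eta_F $ (2 ^ k * M) = sigma3 k * (13 * eta_F $ M + eta_C $ M) - tau k * eta_C $ M"
proof -
  have "eta_C $ (2 ^ k * M) = tau k * eta_C $ M \<and>
    13 * eta_F $ (2 ^ k * M) = sigma3 k * (13 * eta_F $ M + eta_C $ M) - tau k * eta_C $ M"
  proof (induction k rule: tau.induct)
    case 2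
    have "eta_F $ (2 * M) = 9 * eta_F $ M + eta_C $ M" "eta_C $ (2 * M) = - 4 * eta_C $ M"
      using hecke_coeff[of M] M by simp_all
    then show ?case by (simp add: sigma3_def)
  next
    case (3 k)
    have "eta_F $ (2 ^ Suc (Suc k) * M) + 8 * eta_F $ (2 ^ k * M)
        = 9 * eta_F $ (2 ^ Suc k * M) + eta_C $ (2 ^ Suc k * M)"
      "eta_C $ (2 ^ Suc (Suc k) * M) + 8 * eta_C $ (2 ^ k * M) = - 4 * eta_C $ (2 ^ Suc k * M)"
      using hecke_coeff[of "2 ^ Suc k * M"] by (simp_all add: mult.assoc)
    with 3 sigma3_rec[of k] show ?case by (simp del: power_Suc) algebra
  qed (simp_all add: sigma3_def)
  then show "eta_C $ (2 ^ k * M) = tau k * eta_C $ M"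
    "13 * eta_F $ (2 ^ k * M) = sigma3 k * (13 * eta_F $ M + eta_C $ M) - tau k * eta_C $ M" by auto
qed

lemma A5_coeff: "A5 n = eta_F $ (n + 2)"
  by (simp add: eta_F_def A5_gf_def fps_X_power_mult_nth)

theorem theorem1p2:
  shows "(\<forall>n k::nat. k \<ge> 1 \<longrightarrow>
            A5 (2 ^ (k + 1) * n + 3 * 2 ^ k - 2)
              = B k * A5 (4 * n + 4) + ((8 ^ (k + 1) - 1) div 7 - 9 * B k) * A5 (2 * n + 1))
       \<and> (\<forall>m n::nat. ((8::int) ^ (4 * m + 4) - 1) div 91 dvd A5 (2 ^ (4 * m + 4) * n + 3 * 2 ^ (4 * m + 3) - 2))"
proof -
  have idx: "A5 (2 ^ (k + 1) * n + 3 * 2 ^ k - 2) = eta_F $ (2 ^ k * (2 * n + 3))" if "k \<ge> 1"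
      for n k
  proof -
    \<comment> \<open>The subtraction of 2 is on naturals; k >= 1 ensures that it is exact.\<close>
    have "(2::nat) ^ 1 \<le> 2 ^ k" using that by (intro power_increasing) auto
    then have "2 ^ (k + 1) * n + 3 * 2 ^ k - 2 + 2 = 2 ^ k * (2 * n + 3)"
        by (simp add: algebra_simps)
    then show ?thesis by (simp only: A5_coeff)
  qed
  have main: "eta_F $ (2 ^ k * M) = sigma3 k * eta_F $ M + B k * eta_C $ M" if "odd M" for k M
    using coeff_doubling(2)[OF that, of k] B_eq_sigma3_tau[of k] by algebra
  show ?thesis
  proof (intro conjI allI impI)
    fix n k :: nat assume k: "k \<ge> 1"
    have odd: "odd (2 * n + 3)" by simp
    have "4 * n + 4 + 2 = 2 ^ 1 * (2 * n + 3)" "2 * n + 1 + 2 = 2 * n + 3" by simp_all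
    then have "A5 (4 * n + 4) = eta_F $ (2 ^ 1 * (2 * n + 3))"
        "A5 (2 * n + 1) = eta_F $ (2 * n + 3)"
      unfolding A5_coeff by presburger+
    \<comment> \<open>The case k = 1, where sigma3 1 = 9 and B 1 = 1, expresses the coefficient of C
      through values of \<open>A5\<close>.\<close>
    then have "A5 (4 * n + 4) = 9 * A5 (2 * n + 1) + eta_C $ (2 * n + 3)"
      using main[OF odd, of 1] by (simp add: sigma3_def)
    then show "A5 (2 ^ (k + 1) * n + 3 * 2 ^ k - 2)
        = B k * A5 (4 * n + 4) + ((8 ^ (k + 1) - 1) div 7 - 9 * B k) * A5 (2 * n + 1)"
      unfolding idx[OF k] main[OF odd] \<open>A5 (2 * n + 1) = _\<close>[symmetric] sigma3_def[symmetric]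
      by (simp add: algebra_simps)
  next
    fix m n :: nat
    \<comment> \<open>Since \<open>tau\<close> vanishes here, sigma3 = 13 B, and 7 sigma3 = 8^(4m+4)
      - 1: the modulus is B itself.\<close>
    have "91 * B (4 * m + 3) = 8 ^ (4 * m + 4) - 1"
      using B_eq_sigma3_tau[of "4 * m + 3"] tau_zero[of m] sigma3[of "4 * m + 3"]
          by (simp add: add.commute)
    then have "(8 ^ (4 * m + 4) - 1) div 91 = B (4 * m + 3)"
      by (metis nonzero_mult_div_cancel_left zero_neq_numeral)
    moreover have "sigma3 (4 * m + 3) = 13 * B (4 * m + 3)"
      using B_eq_sigma3_tau[of "4 * m + 3"] tau_zero[of m] by simp
    then have "B (4 * m + 3) dvd eta_F $ (2 ^ (4 * m + 3) * (2 * n + 3))"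
      unfolding main[of "2 * n + 3", simplified] by simp
    ultimately show "((8::int) ^ (4 * m + 4) - 1) div 91
        dvd A5 (2 ^ (4 * m + 4) * n + 3 * 2 ^ (4 * m + 3) - 2)"
      using idx[of "4 * m + 3" n] by (simp add: add.commute)
  qed
qed

end
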